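(* There is an $O(N\,\mathrm{poly}(D))$-time reduction from a Restricted OAPT instance with two sets $A,B$ of $N$ tensors of size $D$ to an instance of Subtree Isomorphism on two (rooted, or unrooted) binary trees of size $O(N\,\mathrm{poly}(D))$ and depth $2\log N+O(\log D)$ (the answer is preserved).
   Context: For even $t$, tensors $u,v\in\{0,1\}^{2\times\cdots\times2}$ ($t$ factors, size $D=2^t$) indexed by $i\in\{0,1\}^t$ have alternating product $p_{\mathrm{alt}}(u,v)=\bigwedge_{i_1}\bigvee_{i_2}\bigwedge_{i_3}\cdots\bigvee_{i_t}(u_i\wedge v_i)$. A tensor $x$ is $\wedge$-invariant if $x_i$ does not depend on $i_1,i_3,\dots,i_{t-1}$. Restricted OAPT: given two sets $A,B$ of $N$ such tensors, where one set contains only $\wedge$-invariant tensors, decide whether some $(a,b)\in A\times B$ has $p_{\mathrm{alt}}(a,b)=0$. Subtree Isomorphism: given two (unordered) trees $G,H$, decide whether $G$ is isomorphic to a subtree of $H$ (a tree obtained from $H$ by removing nodes and edges); in the rooted version the root of $G$ must be mapped to the root of $H$. *)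

theory Defs
  imports Complex_Main "HOL-Library.FuncSet"
begin

section \<open>Tensors and Restricted OAPT\<close>

type_synonym tensor = "bool list \<Rightarrow> bool"

definition indices :: "nat \<Rightarrow> bool list set" where
  "indices t = {i. length i = t}"

definition tensors :: "nat \<Rightarrow> tensor set" where
  "tensors t = indices t \<rightarrow>\<^sub>E UNIV"

text \<open>The flag says whether the outermost remaining coordinate carries a conjunction.\<close>

fun alternate :: "bool \<Rightarrow> nat \<Rightarrow> (bool list \<Rightarrow> bool) \<Rightarrow> bool" where
  "alternate q 0 f = f []"
| "alternate True (Suc n) f = (\<forall>b. alternate False n (\<lambda>i. f (b # i)))"
| "alternate False (Suc n) f = (\<exists>b. alternate True n (\<lambda>i. f (b # i)))"

definition p_alt :: "nat \<Rightarrow> tensor \<Rightarrow> tensor \<Rightarrow> bool" where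
  "p_alt t u v = alternate True t (\<lambda>i. u i \<and> v i)"

text \<open>Lists are indexed from 0, so \<open>i\<^sub>2, i\<^sub>4, \<dots>\<close> sit at the odd positions;
  a tensor does not depend on \<open>i\<^sub>1, i\<^sub>3, \<dots>\<close> if these odd positions determine its entries.\<close>

definition and_invariant :: "nat \<Rightarrow> tensor \<Rightarrow> bool" where
  "and_invariant t x \<longleftrightarrow>
     (\<forall>i\<in>indices t. \<forall>j\<in>indices t. (\<forall>k<t. odd k \<longrightarrow> i ! k = j ! k) \<longrightarrow> x i = x j)"

definition restricted_OAPT_instance :: "nat \<Rightarrow> nat \<Rightarrow> tensor set \<Rightarrow> tensor set \<Rightarrow> bool" where
  "restricted_OAPT_instance t N A B \<longleftrightarrow>
     even t \<and> 2 \<le> t \<and> 1 \<le> N \<and>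
     A \<subseteq> tensors t \<and> card A = N \<and> B \<subseteq> tensors t \<and> card B = N \<and>
     ((\<forall>a\<in>A. and_invariant t a) \<or> (\<forall>b\<in>B. and_invariant t b))"

definition OAPT :: "nat \<Rightarrow> tensor set \<Rightarrow> tensor set \<Rightarrow> bool" where
  "OAPT t A B \<longleftrightarrow> (\<exists>a\<in>A. \<exists>b\<in>B. \<not> p_alt t a b)"


section \<open>Trees and Subtree Isomorphism\<close>

record 'v graph =
  verts :: "'v set"
  edges :: "'v set set"

record 'v rooted_graph = "'v graph" +
  root :: 'v

definition adj :: "('v, 'z) graph_scheme \<Rightarrow> ('v \<times> 'v) set" where
  "adj G = {(u, v). {u, v} \<in> edges G}"

definition simple_graph :: "('v, 'z) graph_scheme \<Rightarrow> bool" where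
  "simple_graph G \<longleftrightarrow> finite (verts G) \<and> (\<forall>e\<in>edges G. e \<subseteq> verts G \<and> card e = 2)"

definition connected_graph :: "('v, 'z) graph_scheme \<Rightarrow> bool" where
  "connected_graph G \<longleftrightarrow> verts G \<noteq> {} \<and> (\<forall>u\<in>verts G. \<forall>v\<in>verts G. (u, v) \<in> (adj G)\<^sup>*)"

definition is_cycle :: "('v, 'z) graph_scheme \<Rightarrow> 'v list \<Rightarrow> bool" where
  "is_cycle G p \<longleftrightarrow> 3 \<le> length p \<and> distinct p \<and>
     (\<forall>i<length p. (p ! i, p ! (Suc i mod length p)) \<in> adj G)"

definition tree :: "('v, 'z) graph_scheme \<Rightarrow> bool" where
  "tree G \<longleftrightarrow> simple_graph G \<and> connected_graph G \<and> (\<nexists>p. is_cycle G p)"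

definition subtree :: "('v, 'y) graph_scheme \<Rightarrow> ('v, 'z) graph_scheme \<Rightarrow> bool" where
  "subtree S H \<longleftrightarrow> tree S \<and> verts S \<subseteq> verts H \<and> edges S \<subseteq> edges H"

definition graph_iso ::
    "('u \<Rightarrow> 'v) \<Rightarrow> ('u, 'y) graph_scheme \<Rightarrow> ('v, 'z) graph_scheme \<Rightarrow> bool" where
  "graph_iso f G S \<longleftrightarrow> bij_betw f (verts G) (verts S) \<and>
     (\<forall>u\<in>verts G. \<forall>v\<in>verts G. {u, v} \<in> edges G \<longleftrightarrow> {f u, f v} \<in> edges S)"

text \<open>The unrooted problem ignores the \<open>root\<close> fields.\<close>

definition unrooted_subtree_iso :: "'u rooted_graph \<Rightarrow> 'v rooted_graph \<Rightarrow> bool" where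
  "unrooted_subtree_iso G H \<longleftrightarrow> (\<exists>(S :: 'v graph) f. subtree S H \<and> graph_iso f G S)"

definition rooted_subtree_iso :: "'u rooted_graph \<Rightarrow> 'v rooted_graph \<Rightarrow> bool" where
  "rooted_subtree_iso G H \<longleftrightarrow>
     (\<exists>(S :: 'v graph) f. subtree S H \<and> graph_iso f G S \<and> f (root G) = root H)"

definition level :: "'v rooted_graph \<Rightarrow> 'v \<Rightarrow> nat" where
  "level G v = (LEAST n. (root G, v) \<in> adj G ^^ n)"

definition children :: "'v rooted_graph \<Rightarrow> 'v \<Rightarrow> 'v set" where
  "children G v = {w. (v, w) \<in> adj G \<and> level G w = Suc (level G v)}"

definition depth :: "'v rooted_graph \<Rightarrow> nat" where
  "depth G = Max (level G ` verts G)"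

text \<open>Forgetting the root of such a tree leaves an unrooted tree of maximum degree at most 3.\<close>

definition binary_tree :: "'v rooted_graph \<Rightarrow> bool" where
  "binary_tree G \<longleftrightarrow> tree G \<and> root G \<in> verts G \<and> (\<forall>v\<in>verts G. card (children G v) \<le> 2)"


section \<open>Word RAM\<close>

text \<open>
  Running time is measured on a word RAM, programmed by structured commands.  A program uses
  finitely many named arrays of words (a scalar is cell 0 of its array) with indirect addressing,
  addition, truncated subtraction and comparison.  The bound \<open>W\<close> is the number of representable
  words: a program that produces a word not below \<open>W\<close>, even as an intermediate result or an
  address, has no execution.  Every operation costs one step.
\<close>

type_synonym state = "string \<Rightarrow> nat \<Rightarrow> nat"

datatype aexp = Num nat | Get string aexp | Add aexp aexp | Sub aexp aexp

datatype bexp = Less aexp aexp | Neg bexp | Conj bexp bexp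

datatype com =
    Skip
  | Put string aexp aexp
  | Seq com com
  | Cond bexp com com
  | While bexp com

fun aval :: "aexp \<Rightarrow> state \<Rightarrow> nat" where
  "aval (Num n) s = n"
| "aval (Get x a) s = s x (aval a s)"
| "aval (Add a b) s = aval a s + aval b s"
| "aval (Sub a b) s = aval a s - aval b s"

fun afits :: "nat \<Rightarrow> aexp \<Rightarrow> state \<Rightarrow> bool" where
  "afits W (Num n) s \<longleftrightarrow> n < W"
| "afits W (Get x a) s \<longleftrightarrow> afits W a s \<and> s x (aval a s) < W"
| "afits W (Add a b) s \<longleftrightarrow> afits W a s \<and> afits W b s \<and> aval a s + aval b s < W"
| "afits W (Sub a b) s \<longleftrightarrow> afits W a s \<and> afits W b s"

fun acost :: "aexp \<Rightarrow> nat" where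
  "acost (Num n) = 1"
| "acost (Get x a) = 1 + acost a"
| "acost (Add a b) = 1 + acost a + acost b"
| "acost (Sub a b) = 1 + acost a + acost b"

fun bval :: "bexp \<Rightarrow> state \<Rightarrow> bool" where
  "bval (Less a b) s \<longleftrightarrow> aval a s < aval b s"
| "bval (Neg b) s \<longleftrightarrow> \<not> bval b s"
| "bval (Conj b c) s \<longleftrightarrow> bval b s \<and> bval c s"

fun bfits :: "nat \<Rightarrow> bexp \<Rightarrow> state \<Rightarrow> bool" where
  "bfits W (Less a b) s \<longleftrightarrow> afits W a s \<and> afits W b s"
| "bfits W (Neg b) s \<longleftrightarrow> bfits W b s"
| "bfits W (Conj b c) s \<longleftrightarrow> bfits W b s \<and> bfits W c s"

fun bcost :: "bexp \<Rightarrow> nat" where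
  "bcost (Less a b) = 1 + acost a + acost b"
| "bcost (Neg b) = 1 + bcost b"
| "bcost (Conj b c) = 1 + bcost b + bcost c"

text \<open>\<open>exec W P s T s'\<close>: started in \<open>s\<close>, the program \<open>P\<close> halts in \<open>s'\<close> after \<open>T\<close> steps.\<close>

inductive exec :: "nat \<Rightarrow> com \<Rightarrow> state \<Rightarrow> nat \<Rightarrow> state \<Rightarrow> bool" for W where
  Skip: "exec W Skip s 1 s"
| Put: "afits W i s \<Longrightarrow> afits W a s \<Longrightarrow>
    exec W (Put x i a) s (1 + acost i + acost a) (s(x := (s x)(aval i s := aval a s)))"
| Seq: "exec W P s T s' \<Longrightarrow> exec W Q s' T' s'' \<Longrightarrow> exec W (Seq P Q) s (T + T') s''"
| CondTrue: "bfits W b s \<Longrightarrow> bval b s \<Longrightarrow> exec W P s T s' \<Longrightarrow>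
    exec W (Cond b P Q) s (1 + bcost b + T) s'"
| CondFalse: "bfits W b s \<Longrightarrow> \<not> bval b s \<Longrightarrow> exec W Q s T s' \<Longrightarrow>
    exec W (Cond b P Q) s (1 + bcost b + T) s'"
| WhileFalse: "bfits W b s \<Longrightarrow> \<not> bval b s \<Longrightarrow> exec W (While b P) s (1 + bcost b) s"
| WhileTrue: "bfits W b s \<Longrightarrow> bval b s \<Longrightarrow> exec W P s T s' \<Longrightarrow> exec W (While b P) s' T' s'' \<Longrightarrow>
    exec W (While b P) s (1 + bcost b + T + T') s''"

inductive_cases exec_SkipE: "exec W Skip s T s'"
inductive_cases exec_PutE: "exec W (Put x i a) s T s'"
inductive_cases exec_SeqE: "exec W (Seq P Q) s T s'"
inductive_cases exec_CondE: "exec W (Cond b P Q) s T s'"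
inductive_cases exec_WhileE: "exec W (While b P) s T s'"

lemma exec_deterministic:
  "exec W P s T s' \<Longrightarrow> exec W P s U u \<Longrightarrow> T = U \<and> s' = u"
proof (induction arbitrary: U u rule: exec.induct)
  case (Skip s)
  then show ?case by (auto elim: exec_SkipE)
next
  case (Put i s a x)
  then show ?case by (auto elim: exec_PutE)
next
  case (Seq P s T s' Q T' s'')
  show ?case
    by (rule exec_SeqE[OF Seq.prems]) (auto dest!: Seq.IH)
next
  case (CondTrue b s P T s' Q)
  show ?case
    by (rule exec_CondE[OF CondTrue.prems]) (auto dest!: CondTrue.IH simp: CondTrue.hyps(2))
next
  case (CondFalse b s Q T s' P)
  show ?case
    by (rule exec_CondE[OF CondFalse.prems]) (auto dest!: CondFalse.IH simp: CondFalse.hyps(2))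
next
  case (WhileFalse b s P)
  show ?case
    by (rule exec_WhileE[OF WhileFalse.prems]) (auto simp: WhileFalse.hyps(2))
next
  case (WhileTrue b s P T s' T' s'')
  show ?case
    by (rule exec_WhileE[OF WhileTrue.prems]) (auto dest!: WhileTrue.IH simp: WhileTrue.hyps(2))
qed


section \<open>Input and output of the reduction\<close>

text \<open>The \<open>m\<close>-th index in lexicographic order (\<open>i\<^sub>1\<close> is the most significant bit).\<close>

definition nth_index :: "nat \<Rightarrow> nat \<Rightarrow> bool list" where
  "nth_index t m = map (\<lambda>k. odd (m div 2 ^ (t - 1 - k))) [0..<t]"

definition enumerates :: "'a list \<Rightarrow> 'a set \<Rightarrow> bool" where
  "enumerates xs X \<longleftrightarrow> distinct xs \<and> set xs = X"

text \<open>The entries of the tensors in a list, one after the other, \<open>2 ^ t\<close> cells for each.\<close>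

definition tensor_array :: "nat \<Rightarrow> tensor list \<Rightarrow> nat \<Rightarrow> nat" where
  "tensor_array t us p =
     (if p < length us * 2 ^ t then of_bool ((us ! (p div 2 ^ t)) (nth_index t (p mod 2 ^ t))) else 0)"

definition input_state :: "nat \<Rightarrow> tensor list \<Rightarrow> tensor list \<Rightarrow> state" where
  "input_state t as bs = (\<lambda>_ _. 0)
     (''t'' := (\<lambda>_. 0)(0 := t),
      ''D'' := (\<lambda>_. 0)(0 := 2 ^ t),
      ''N'' := (\<lambda>_. 0)(0 := length as),
      ''A'' := tensor_array t as,
      ''B'' := tensor_array t bs)"

text \<open>A tree is output as its number \<open>n\<close> of nodes \<open>0, \<dots>, n - 1\<close>, its root, and the array of
  parents of all other nodes.\<close>

definition parent_graph :: "nat \<Rightarrow> nat \<Rightarrow> (nat \<Rightarrow> nat) \<Rightarrow> nat rooted_graph" where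
  "parent_graph n r par =
     \<lparr>verts = {..<n}, edges = {{v, par v} | v. v < n \<and> v \<noteq> r}, root = r\<rparr>"

definition output_G :: "state \<Rightarrow> nat rooted_graph" where
  "output_G s = parent_graph (s ''G_size'' 0) (s ''G_root'' 0) (s ''G_parent'')"

definition output_H :: "state \<Rightarrow> nat rooted_graph" where
  "output_H s = parent_graph (s ''H_size'' 0) (s ''H_root'' 0) (s ''H_parent'')"

end

theory Submission
  imports Defs
begin

text \<open>
  Negating the alternating product turns it into \<open>\<Or>\<And>\<Or>\<And>\<dots>\<close> over \<open>\<not> a\<^sub>i \<or> \<not> b\<^sub>i\<close>, which a rooted
  embedding can express: at an AND node both children have to be embedded, and at an OR node the
  tree of \<open>b\<close> offers two children of which the single child of the tree of \<open>a\<close> picks one.  This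
  needs \<open>a\<close> to ignore the OR coordinates, that is, to be \<open>\<and>\<close>-invariant.  The tree \<open>G\<close> is a complete
  binary tree of depth \<open>n \<approx> log N\<close> whose leaves carry a path of length about \<open>n\<close> and the gadget of
  one \<open>a\<close>.  In \<open>H\<close> all leaves but one of a complete binary tree carry a gadget into which everything
  embeds, and the remaining leaf carries a second complete tree with the gadgets of all \<open>b\<close>; an
  embedding thus selects some \<open>a\<close> for this leaf, and its path selects some \<open>b\<close>.  Both children of
  the root of \<open>G\<close> have maximal height, which forces even an unrooted embedding to preserve the root.

  Both trees unfold from a root label by a local rule that gives each label its at most two successor
  labels, so a single queue writes their parent arrays in constant time per node.
\<close>

section \<open>Parent arrays and rooted embeddings\<close>

text \<open>A path of length about \<open>log N\<close> below each of up to \<open>2 N\<close>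
  leaves seems to cost a factor \<open>log N\<close>. It is affordable because the tensors are
  distinct: \<open>N \<le> 2 ^ D\<close>, so the path is no longer than the order of the gadget of
  size \<open>O(D)\<close> beneath it.

  The instance does not say which of the two sets is invariant. The program therefore tests
  \<open>A\<close> and exchanges the roles of the sets if the test fails, which is sound because the
  alternating product is symmetric. As the machine has neither multiplication nor division, the
  indices with cleared OR coordinates come from a table filled by doubling, and all leaf addresses
  are obtained by doubling and adding.

  Embeddings are decided on terms, where \<open>emb\<close> is a structural recursion. The passage
  from graphs to terms rests on one observation: once an injective homomorphism sends an edge
  downwards, everything below that edge goes downwards too. \<open>G\<close> and \<open>H\<close>
  have exactly the same height, which gives the depth bound and leaves no room for an embedding that
  moves the root.\<close>

datatype btree = Empty | Node btree btree

text \<open>Rooted embedding of unordered trees. \<open>Empty\<close> stands for a missing child, so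
  both assignments of the children have to be allowed.\<close>

fun emb :: "btree \<Rightarrow> btree \<Rightarrow> bool" where
  "emb Empty t \<longleftrightarrow> True"
| "emb (Node l r) Empty \<longleftrightarrow> False"
| "emb (Node l r) (Node l' r') \<longleftrightarrow> emb l l' \<and> emb r r' \<or> emb l r' \<and> emb r l'"

primrec height :: "btree \<Rightarrow> nat" where
  "height Empty = 0"
| "height (Node l r) = Suc (max (height l) (height r))"

primrec nodes :: "btree \<Rightarrow> nat" where
  "nodes Empty = 0"
| "nodes (Node l r) = Suc (nodes l + nodes r)"

definition kids :: "nat \<Rightarrow> (nat \<Rightarrow> nat) \<Rightarrow> nat \<Rightarrow> nat set" where
  "kids n par v = {w. 0 < w \<and> w < n \<and> par w = v}"

lemma kids_iff: "w \<in> kids n par v \<longleftrightarrow> 0 < w \<and> w < n \<and> par w = v"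
  by (simp add: kids_def)

text \<open>A queue numbers parents before children. With \<open>par v < v\<close>, induction on the
  node number replaces induction on the tree.\<close>

locale parent_tree =
  fixes n :: nat and par :: "nat \<Rightarrow> nat"
  assumes pos: "0 < n" and par_less: "\<And>v. 0 < v \<Longrightarrow> v < n \<Longrightarrow> par v < v"
begin

abbreviation "gr \<equiv> parent_graph n 0 par"

lemma verts_gr [simp]: "verts gr = {..<n}" and root_gr [simp]: "root gr = 0"
  by (simp_all add: parent_graph_def)

lemma edge_iff:
  "{u, v} \<in> edges gr \<longleftrightarrow> (0 < u \<and> u < n \<and> v = par u) \<or> (0 < v \<and> v < n \<and> u = par v)"
  by (auto simp: parent_graph_def doubleton_eq_iff)

lemma adj_iff:
  "(u, v) \<in> adj gr \<longleftrightarrow> (0 < u \<and> u < n \<and> v = par u) \<or> (0 < v \<and> v < n \<and> u = par v)"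
  by (simp add: adj_def edge_iff)

lemma sym_adj: "(u, v) \<in> adj gr \<Longrightarrow> (v, u) \<in> adj gr"
  by (auto simp: adj_iff)

lemma simple_gr: "simple_graph gr"
proof -
  have "e \<subseteq> {..<n} \<and> card e = 2" if "e \<in> edges gr" for e
  proof -
    from that obtain v where v: "e = {v, par v}" "0 < v" "v < n"
      by (auto simp: parent_graph_def)
    then show ?thesis using par_less[of v] by auto
  qed
  then show ?thesis by (simp add: simple_graph_def)
qed

lemma reach_root: "v < n \<Longrightarrow> (v, 0) \<in> (adj gr)\<^sup>*"
proof (induction v rule: less_induct)
  case (less v)
  show ?case
  proof (cases "v = 0")
    case False
    then have "(v, par v) \<in> adj gr" "par v < v" using less.prems par_less by (auto simp: adj_iff)
    then show ?thesis using less by (meson converse_rtrancl_into_rtrancl less_trans)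
  qed simp
qed

lemma connected_gr: "connected_graph gr"
proof -
  have "sym ((adj gr)\<^sup>*)" by (intro sym_rtrancl symI) (rule sym_adj)
  then have "(u, v) \<in> (adj gr)\<^sup>*" if "u < n" "v < n" for u v
    using reach_root[OF that(1)] reach_root[OF that(2)] by (meson rtrancl_trans symD)
  then show ?thesis using pos by (auto simp: connected_graph_def)
qed

text \<open>The largest node of a cycle would have two distinct smaller neighbours, but only its
  parent is a smaller neighbour.\<close>

lemma acyclic_gr: "\<not> is_cycle gr p"
proof
  assume c: "is_cycle gr p"
  let ?L = "length p"
  have L: "3 \<le> ?L" and d: "distinct p"
    and a: "\<And>i. i < ?L \<Longrightarrow> (p ! i, p ! (Suc i mod ?L)) \<in> adj gr"
    using c by (auto simp: is_cycle_def)
  have ne: "set p \<noteq> {}" using L by auto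
  then have "Max (set p) \<in> set p" by simp
  then obtain i where i: "i < ?L" "p ! i = Max (set p)" by (metis in_set_conv_nth)
  \<comment> \<open>\<open>s\<close> and \<open>q\<close> are the cyclic successor and predecessor
    of \<open>i\<close>; they differ because a cycle has at least three nodes.\<close>
  define s where "s = Suc i mod ?L"
  define q where "q = (if i = 0 then ?L - 1 else i - 1)"
  have q: "q < ?L" "Suc q mod ?L = i" using i L by (auto simp: q_def)
  have s: "s < ?L" using L unfolding s_def by (intro mod_less_divisor) linarith
  have sv: "s = (if Suc i = ?L then 0 else Suc i)" using i by (auto simp: s_def)
  have ds: "s \<noteq> i" "q \<noteq> i" "s \<noteq> q" using i L by (auto simp: sv q_def)
  have less: "p ! k < p ! i" if "k < ?L" "k \<noteq> i" for k
  proof -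
    have "p ! k \<le> p ! i" using that i by simp
    moreover have "p ! k \<noteq> p ! i" using that i(1) d by (simp add: nth_eq_iff_index_eq)
    ultimately show ?thesis by simp
  qed
  have up: "w = par v" if "(v, w) \<in> adj gr" "w < v" for v w
    using that par_less[of w] by (auto simp: adj_iff)
  have "(p ! i, p ! s) \<in> adj gr" using a[OF i(1)] by (simp add: s_def)
  moreover have "(p ! i, p ! q) \<in> adj gr" using a[OF q(1)] q(2) sym_adj by simp
  ultimately have "p ! s = p ! q" using up less s q ds by metis
  then show False using d s q ds by (simp add: nth_eq_iff_index_eq)
qed

lemma tree_gr: "tree gr"
  by (simp add: tree_def simple_gr connected_gr acyclic_gr)

text \<open>A substitute for \<open>level\<close> that recurses along parents; the definition of
  \<open>level\<close> by shortest walks does not.\<close>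

definition steps_up :: "nat \<Rightarrow> nat" where
  "steps_up v = (LEAST k. (par ^^ k) v = 0)"

lemma iterate_par_0: "v < n \<Longrightarrow> \<exists>k. (par ^^ k) v = 0"
proof (induction v rule: less_induct)
  case (less v)
  show ?case
  proof (cases "v = 0")
    case True then show ?thesis by (intro exI[of _ 0]) simp
  next
    case False
    then have "par v < v" using less.prems par_less by auto
    then obtain k where "(par ^^ k) (par v) = 0" using less by (meson less_trans)
    then show ?thesis by (intro exI[of _ "Suc k"]) (simp add: funpow_swap1)
  qed
qed

lemma steps_up_0: "steps_up 0 = 0"
  unfolding steps_up_def by (rule Least_eq_0) simp

lemma steps_up_Suc: assumes "0 < v" "v < n" shows "steps_up v = Suc (steps_up (par v))"
proof -
  obtain k where "(par ^^ k) v = 0" using iterate_par_0 assms by auto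
  then have "steps_up v = Suc (LEAST k. (par ^^ Suc k) v = 0)"
    unfolding steps_up_def by (rule Least_Suc) (use assms in simp)
  then show ?thesis by (simp add: steps_up_def funpow_swap1)
qed

text \<open>One edge changes \<open>steps_up\<close> by at most one, so no walk from the root is
  shorter than the climb along parents.\<close>

lemma walk_bound: "(u, v) \<in> adj gr ^^ k \<Longrightarrow> steps_up v \<le> steps_up u + k"
proof (induction k arbitrary: v)
  case (Suc k)
  then obtain w where w: "(u, w) \<in> adj gr ^^ k" "(w, v) \<in> adj gr" by auto
  then have "steps_up v \<le> Suc (steps_up w)" using steps_up_Suc by (auto simp: adj_iff)
  then show ?case using Suc.IH[OF w(1)] by simp
qed auto

lemma walk_exists: "v < n \<Longrightarrow> (0, v) \<in> adj gr ^^ steps_up v"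
proof (induction v rule: less_induct)
  case (less v)
  show ?case
  proof (cases "v = 0")
    case False
    then have v: "par v < v" "steps_up v = Suc (steps_up (par v))" "(par v, v) \<in> adj gr"
      using less.prems par_less steps_up_Suc by (auto simp: adj_iff)
    then show ?thesis using less by auto
  qed (simp add: steps_up_0)
qed

lemma level_eq_steps_up: "v < n \<Longrightarrow> level gr v = steps_up v"
  unfolding level_def using walk_exists walk_bound[of 0 v] steps_up_0
  by (intro Least_equality) (auto simp: parent_graph_def)

lemma level_root: "level gr 0 = 0"
  using level_eq_steps_up pos steps_up_0 by simp

lemma level_Suc: "0 < v \<Longrightarrow> v < n \<Longrightarrow> level gr v = Suc (level gr (par v))"
  using par_less[of v] by (simp add: level_eq_steps_up steps_up_Suc)

lemma children_eq_kids:
  assumes "v < n" shows "children gr v = kids n par v"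
proof -
  have "par w < n" if "0 < w" "w < n" for w using par_less[OF that] that by simp
  then show ?thesis
    using assms level_Suc by (auto simp: children_def kids_def adj_iff)
qed

end

text \<open>\<open>\<tau> v\<close> describes the subtree below \<open>v\<close> with its children
  in some order; a single child always stands on the left.\<close>

definition shaped_at :: "nat \<Rightarrow> (nat \<Rightarrow> nat) \<Rightarrow> (nat \<Rightarrow> btree) \<Rightarrow> nat \<Rightarrow> bool" where
  "shaped_at n par \<tau> v \<longleftrightarrow>
    (kids n par v = {} \<and> \<tau> v = Node Empty Empty) \<or>
    (\<exists>w. kids n par v = {w} \<and> \<tau> v = Node (\<tau> w) Empty) \<or>
    (\<exists>w w'. w \<noteq> w' \<and> kids n par v = {w, w'} \<and> \<tau> v = Node (\<tau> w) (\<tau> w'))"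

locale shaped_tree = parent_tree +
  fixes \<tau> :: "nat \<Rightarrow> btree"
  assumes shaped: "\<And>v. v < n \<Longrightarrow> shaped_at n par \<tau> v"
begin

lemmas shape = shaped[unfolded shaped_at_def]

lemma \<tau>_nonempty: "v < n \<Longrightarrow> \<tau> v \<noteq> Empty"
  using shape[of v] by auto

lemma card_kids: "v < n \<Longrightarrow> card (kids n par v) \<le> 2"
  using shape[of v] by (auto simp: card_insert_if)

lemma binary_gr: "binary_tree gr"
  using tree_gr pos card_kids by (auto simp: binary_tree_def children_eq_kids)

lemma height_kid: assumes "w \<in> kids n par v" "v < n" shows "height (\<tau> w) < height (\<tau> v)"
  using shape[OF assms(2)] assms(1) by auto

text \<open>Along an edge to a child the level grows by exactly one and the height drops by at least
  one.\<close>

lemma level_height: "v < n \<Longrightarrow> level gr v + height (\<tau> v) \<le> height (\<tau> 0)"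
proof (induction v rule: less_induct)
  case (less v)
  show ?case
  proof (cases "v = 0")
    case False
    then have v: "0 < v" "par v < v" using less.prems par_less by auto
    then have "v \<in> kids n par (par v)" "par v < n" using less.prems by (auto simp: kids_iff)
    then have "height (\<tau> v) < height (\<tau> (par v))" by (rule height_kid)
    then show ?thesis using less.IH[OF v(2)] level_Suc[OF v(1) less.prems] v less.prems by simp
  qed (simp add: level_root)
qed

lemma level_less_height: "v < n \<Longrightarrow> level gr v < height (\<tau> 0)"
  using level_height[of v] \<tau>_nonempty[of v] by (cases "\<tau> v") auto

lemma depth_less_height: "depth gr < height (\<tau> 0)"
proof -
  have "{..<n} \<noteq> {}" using pos by auto
  then show ?thesis unfolding depth_def using level_less_height
    by (subst Max_less_iff) auto
qed

end

text \<open>The bridge between terms and graphs: the two alternatives in \<open>emb\<close> are the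
  injective maps between sets of at most two children. A child has a nonempty term and hence cannot
  be sent to a missing child.\<close>

lemma (in shaped_tree) emb_kids:
  assumes "shaped_tree m q \<sigma>" "v < n" "v' < m"
  shows "emb (\<tau> v) (\<sigma> v') \<longleftrightarrow>
    (\<exists>g. inj_on g (kids n par v) \<and> g ` kids n par v \<subseteq> kids m q v' \<and>
         (\<forall>w\<in>kids n par v. emb (\<tau> w) (\<sigma> (g w))))" (is "_ \<longleftrightarrow> ?R")
proof -
  interpret H: shaped_tree m q \<sigma> by (fact assms(1))
  have ne: "\<tau> w \<noteq> Empty" if "w \<in> kids n par v" for w
    using that \<tau>_nonempty by (auto simp: kids_iff)
  have ne1: "\<not> emb (\<tau> w) Empty" if "w \<in> kids n par v" for w
    using ne[OF that] by (cases "\<tau> w") auto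
  have two: "?R \<longleftrightarrow> (\<exists>x x'. x \<noteq> x' \<and> {x, x'} \<subseteq> kids m q v' \<and> emb (\<tau> w) (\<sigma> x) \<and> emb (\<tau> w') (\<sigma> x'))"
    if "w \<noteq> w'" "kids n par v = {w, w'}" for w w'
  proof
    assume ?R then show "\<exists>x x'. x \<noteq> x' \<and> {x, x'} \<subseteq> kids m q v' \<and> emb (\<tau> w) (\<sigma> x) \<and> emb (\<tau> w') (\<sigma> x')"
      using that by (auto simp: inj_on_def)
  next
    assume "\<exists>x x'. x \<noteq> x' \<and> {x, x'} \<subseteq> kids m q v' \<and> emb (\<tau> w) (\<sigma> x) \<and> emb (\<tau> w') (\<sigma> x')"
    then obtain x x' where "x \<noteq> x'" "{x, x'} \<subseteq> kids m q v'" "emb (\<tau> w) (\<sigma> x)" "emb (\<tau> w') (\<sigma> x')"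
      by blast
    then show ?R using that
      by (intro exI[of _ "\<lambda>y. if y = w then x else x'"]) (auto simp: inj_on_def)
  qed
  have one: "?R \<longleftrightarrow> (\<exists>x. x \<in> kids m q v' \<and> emb (\<tau> w) (\<sigma> x))"
    if "kids n par v = {w}" for w
    using that by auto
  have zero: ?R if "kids n par v = {}" using that by auto
  from shape[OF assms(2)] consider "kids n par v = {}" "\<tau> v = Node Empty Empty"
    | w where "kids n par v = {w}" "\<tau> v = Node (\<tau> w) Empty"
    | w w' where "w \<noteq> w'" "kids n par v = {w, w'}" "\<tau> v = Node (\<tau> w) (\<tau> w')"
    by blast
  then show ?thesis
  proof cases
    case 1
    then have "emb (\<tau> v) (\<sigma> v')" using H.\<tau>_nonempty[OF assms(3)] by (cases "\<sigma> v'") auto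
    then show ?thesis using zero[OF 1(1)] by blast
  next
    case (2 w)
    have "\<not> emb (\<tau> w) Empty" using ne1 2 by simp
    then show ?thesis unfolding one[OF 2(1)] 2(2) using H.shape[OF assms(3)] by auto
  next
    case (3 w w')
    have "\<not> emb (\<tau> w) Empty" "\<not> emb (\<tau> w') Empty" using ne1 3 by simp_all
    then show ?thesis unfolding two[OF 3(1,2)] 3(3) using H.shape[OF assms(3)] by auto metis+
  qed
qed

section \<open>Graph embeddings between two trees described by terms\<close>

locale tree_pair = G: shaped_tree n par \<tau> + H: shaped_tree m q \<sigma>
  for n par \<tau> m q \<sigma>
begin

text \<open>The neighbours of \<open>f v\<close> are its parent and its children. The parent is
  already taken by \<open>f (par v)\<close>, so injectivity sends every child of \<open>v\<close> to
  a child of \<open>f v\<close>.\<close>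

lemma downward:
  assumes inj: "inj_on f {..<n}" and hom: "\<And>u v. (u, v) \<in> adj G.gr \<Longrightarrow> (f u, f v) \<in> adj H.gr"
    and v: "0 < v" "v < n" "0 < f v" "q (f v) = f (par v)" and w: "w \<in> kids n par v"
  shows "0 < f w \<and> f w < m \<and> q (f w) = f v"
proof -
  have w': "0 < w" "w < n" "par w = v" using w by (auto simp: kids_iff)
  then have "(f v, f w) \<in> adj H.gr" using v by (intro hom) (auto simp: G.adj_iff)
  moreover have "f w \<noteq> f (par v)"
    using inj_onD[OF inj, of w "par v"] w' v G.par_less[of w] G.par_less[of v] by auto
  ultimately show ?thesis using v by (auto simp: H.adj_iff)
qed

definition rooted_map :: "(nat \<Rightarrow> nat) \<Rightarrow> bool" where
  "rooted_map f \<longleftrightarrow> inj_on f {..<n} \<and> f ` {..<n} \<subseteq> {..<m} \<and> f 0 = 0 \<and>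
     (\<forall>v. 0 < v \<and> v < n \<longrightarrow> 0 < f v \<and> q (f v) = f (par v))"

text \<open>The root of \<open>H\<close> has no parent, so the first edges go downwards, and
  \<open>downward\<close> propagates this to all nodes.\<close>

lemma rooted_mapI:
  assumes inj: "inj_on f {..<n}" and ran: "f ` {..<n} \<subseteq> {..<m}" and f0: "f 0 = 0"
    and hom: "\<And>u v. (u, v) \<in> adj G.gr \<Longrightarrow> (f u, f v) \<in> adj H.gr"
  shows "rooted_map f"
proof -
  have "0 < f v \<and> q (f v) = f (par v)" if "0 < v" "v < n" for v
    using that
  proof (induction v rule: less_induct)
    case (less v)
    have pv: "par v < v" using less.prems G.par_less by auto
    have k: "v \<in> kids n par (par v)" using less.prems by (auto simp: kids_iff)
    show ?case
    proof (cases "par v = 0")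
      case True
      then have "(0, v) \<in> adj G.gr" using less.prems by (auto simp: G.adj_iff)
      then have "(f 0, f v) \<in> adj H.gr" by (rule hom)
      then show ?thesis using f0 True by (auto simp: H.adj_iff)
    next
      case False
      then have "0 < f (par v) \<and> q (f (par v)) = f (par (par v))"
        using less.IH[OF pv] pv less.prems by simp
      then show ?thesis using downward[OF inj hom _ _ _ _ k] False pv less.prems by auto
    qed
  qed
  then show ?thesis using assms by (auto simp: rooted_map_def)
qed

lemma rooted_map_hom:
  assumes "rooted_map f" "(u, v) \<in> adj G.gr"
  shows "(f u, f v) \<in> adj H.gr"
proof -
  have f: "0 < f v \<and> f v < m \<and> q (f v) = f (par v)" if "0 < v" "v < n" for v
    using assms(1) that by (auto simp: rooted_map_def image_subset_iff)
  show ?thesis using assms(2) f[of u] f[of v] unfolding G.adj_iff H.adj_iff by metis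
qed

lemma iso_imp_hom:
  fixes S :: "nat graph"
  assumes "subtree S H.gr" "graph_iso f G.gr S"
  shows "inj_on f {..<n}" "f ` {..<n} \<subseteq> {..<m}" "(u, v) \<in> adj G.gr \<Longrightarrow> (f u, f v) \<in> adj H.gr"
proof -
  have b: "bij_betw f {..<n} (verts S)" using assms(2) by (simp add: graph_iso_def)
  then show "inj_on f {..<n}" by (rule bij_betw_imp_inj_on)
  show "f ` {..<n} \<subseteq> {..<m}"
    using b assms(1) by (auto simp: subtree_def bij_betw_def)
  show "(f u, f v) \<in> adj H.gr" if "(u, v) \<in> adj G.gr"
  proof -
    have "u < n" "v < n" using that G.par_less by (auto simp: G.adj_iff intro: less_trans)
    then show ?thesis using that assms by (auto simp: adj_def subtree_def graph_iso_def)
  qed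
qed

text \<open>The image of \<open>G\<close> serves as the subtree: it is connected because
  \<open>G\<close> is and acyclic because \<open>H\<close> is.\<close>

lemma rooted_map_imp_iso:
  assumes f: "rooted_map f"
  shows "rooted_subtree_iso G.gr H.gr"
proof -
  define S :: "nat graph" where "S = \<lparr>verts = f ` {..<n}, edges = (`) f ` edges G.gr\<rparr>"
  have inj: "inj_on f {..<n}" and ran: "f ` {..<n} \<subseteq> {..<m}" and f0: "f 0 = 0"
    using f by (auto simp: rooted_map_def)
  have e: "\<exists>u v. e = {u, v} \<and> u < n \<and> v < n \<and> (u, v) \<in> adj G.gr" if e: "e \<in> edges G.gr" for e
  proof -
    obtain v where v: "e = {v, par v}" "0 < v" "v < n"
      using e by (auto simp: parent_graph_def)
    then show ?thesis using G.par_less[of v] by (intro exI[of _ v] exI[of _ "par v"]) (auto simp: G.adj_iff)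
  qed
  have sub: "edges S \<subseteq> edges H.gr"
  proof
    fix x assume "x \<in> edges S"
    then obtain d where "x = f ` d" "d \<in> edges G.gr" by (auto simp: S_def)
    with e[of d] obtain u v where "x = {f u, f v}" "(u, v) \<in> adj G.gr" by auto
    then show "x \<in> edges H.gr" using rooted_map_hom[OF f] by (auto simp: adj_def)
  qed
  have adjS: "(f u, f v) \<in> adj S" if "(u, v) \<in> adj G.gr" for u v
  proof -
    have "{f u, f v} = f ` {u, v}" by simp
    then show ?thesis using that unfolding adj_def S_def by (auto simp del: image_insert)
  qed
  have conn: "(f u, f v) \<in> (adj S)\<^sup>*" if "(u, v) \<in> (adj G.gr)\<^sup>*" for u v
    using that by (induction rule: rtrancl_induct) (auto dest: adjS intro: rtrancl_into_rtrancl)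
  have "tree S"
    unfolding tree_def
  proof (intro conjI)
    have "d \<subseteq> f ` {..<n}" if d: "d \<in> edges S" for d
    proof -
      obtain d' where "d = f ` d'" "d' \<in> edges G.gr" using d by (auto simp: S_def)
      then show ?thesis using e[of d'] by auto
    qed
    then show "simple_graph S" using H.simple_gr sub
      by (auto simp: simple_graph_def S_def)
    show "connected_graph S" using G.connected_gr conn G.pos
      by (auto simp: connected_graph_def S_def)
    have "adj S \<subseteq> adj H.gr" using sub by (auto simp: adj_def)
    then have "is_cycle S p \<Longrightarrow> is_cycle H.gr p" for p by (auto simp: is_cycle_def)
    then show "\<nexists>p. is_cycle S p" using H.acyclic_gr by blast
  qed
  then have "subtree S H.gr" using sub ran by (simp add: subtree_def) (simp add: S_def)
  moreover have "graph_iso f G.gr S"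
    unfolding graph_iso_def
  proof (intro conjI ballI)
    show "bij_betw f (verts G.gr) (verts S)" using inj by (simp add: S_def bij_betw_def)
    fix u v assume uv: "u \<in> verts G.gr" "v \<in> verts G.gr"
    have "{f u, f v} \<in> edges S \<Longrightarrow> {u, v} \<in> edges G.gr"
    proof -
      assume "{f u, f v} \<in> edges S"
      then obtain d where "{f u, f v} = f ` d" "d \<in> edges G.gr" by (auto simp: S_def)
      with e[of d] obtain x y where
        xy: "{f u, f v} = f ` {x, y}" "x < n" "y < n" "(x, y) \<in> adj G.gr" by blast
      then have "f ` {u, v} = f ` {x, y}" by simp
      then have "{u, v} = {x, y}" using inj uv xy by (subst (asm) inj_on_image_eq_iff) auto
      then show ?thesis using xy by (simp add: adj_def)
    qed
    then show "{u, v} \<in> edges G.gr \<longleftrightarrow> {f u, f v} \<in> edges S"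
      using adjS by (auto simp: adj_def)
  qed
  ultimately show ?thesis using f0 unfolding rooted_subtree_iso_def by auto
qed

lemma rooted_map_imp_emb:
  assumes f: "rooted_map f"
  shows "v < n \<Longrightarrow> emb (\<tau> v) (\<sigma> (f v))"
proof (induction "height (\<tau> v)" arbitrary: v rule: less_induct)
  case less
  have inj: "inj_on f {..<n}" and ran: "f ` {..<n} \<subseteq> {..<m}"
    and q: "\<And>v. 0 < v \<Longrightarrow> v < n \<Longrightarrow> 0 < f v \<and> q (f v) = f (par v)"
    using f by (auto simp: rooted_map_def)
  have "emb (\<tau> w) (\<sigma> (f w))" if "w \<in> kids n par v" for w
    using less.hyps[OF G.height_kid[OF that less.prems]] that by (simp add: kids_iff)
  moreover have "inj_on f (kids n par v)" using inj by (auto simp: inj_on_def kids_iff)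
  moreover have "f ` kids n par v \<subseteq> kids m q (f v)"
    using q ran by (auto simp: kids_iff image_subset_iff)
  moreover have "f v < m" using ran less.prems by auto
  ultimately show ?case
    by (subst G.emb_kids[OF H.shaped_tree_axioms less.prems]) auto
qed

text \<open>The local injections between children are glued from the root downwards: the image of a
  node is chosen by the injection that belongs to its parent and the image of that parent.\<close>

lemma emb_imp_rooted_map:
  assumes emb: "emb (\<tau> 0) (\<sigma> 0)"
  shows "\<exists>f. rooted_map f"
proof -
  \<comment> \<open>The premises stand below the quantifier so that \<open>choice\<close> yields one
    function for all pairs of nodes.\<close>
  have "\<exists>g. v < n \<and> v' < m \<and> emb (\<tau> v) (\<sigma> v') \<longrightarrow>
      inj_on g (kids n par v) \<and> g ` kids n par v \<subseteq> kids m q v' \<and>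
      (\<forall>w\<in>kids n par v. emb (\<tau> w) (\<sigma> (g w)))" for v v'
    by (cases "v < n \<and> v' < m") (use G.emb_kids[OF H.shaped_tree_axioms, of v v'] in auto)
  then have "\<exists>g. \<forall>v v'. v < n \<and> v' < m \<and> emb (\<tau> v) (\<sigma> v') \<longrightarrow>
      inj_on (g v v') (kids n par v) \<and> g v v' ` kids n par v \<subseteq> kids m q v' \<and>
      (\<forall>w\<in>kids n par v. emb (\<tau> w) (\<sigma> (g v v' w)))"
    by (intro choice allI) blast
  then obtain g where g: "\<And>v v'. v < n \<Longrightarrow> v' < m \<Longrightarrow> emb (\<tau> v) (\<sigma> v') \<Longrightarrow>
      inj_on (g v v') (kids n par v) \<and> g v v' ` kids n par v \<subseteq> kids m q v' \<and>
      (\<forall>w\<in>kids n par v. emb (\<tau> w) (\<sigma> (g v v' w)))" by blast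
  define F where "F = (\<lambda>r v. if v = 0 then 0 else g (par v) (r (par v)) (v::nat))"
  define f where "f = wfrec {(par v, v) | v. 0 < v \<and> v < n} F"
  have wf: "wf {(par v, v) | v. 0 < v \<and> v < n}"
    by (rule wf_subset[OF wf_less]) (auto simp: G.par_less)
  have f0: "f 0 = 0" unfolding f_def by (subst wfrec[OF wf]) (simp add: F_def)
  have fS: "f v = g (par v) (f (par v)) v" if "0 < v" "v < n" for v
    unfolding f_def by (subst wfrec[OF wf]) (use that in \<open>auto simp: F_def cut_def\<close>)
  have emb_f: "f v < m \<and> emb (\<tau> v) (\<sigma> (f v)) \<and> (0 < v \<longrightarrow> 0 < f v \<and> q (f v) = f (par v))"
    if "v < n" for v
    using that
  proof (induction v rule: less_induct)
    case (less v)
    show ?case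
    proof (cases "v = 0")
      case True then show ?thesis using f0 emb H.pos by simp
    next
      case False
      then have v: "0 < v" "par v < v" "v \<in> kids n par (par v)"
        using less.prems G.par_less by (auto simp: kids_iff)
      then have "f (par v) < m \<and> emb (\<tau> (par v)) (\<sigma> (f (par v)))" using less by auto
      then have "f v \<in> kids m q (f (par v)) \<and> emb (\<tau> v) (\<sigma> (f v))"
        using g[of "par v" "f (par v)"] v less.prems fS by auto
      then show ?thesis by (auto simp: kids_iff)
    qed
  qed
  \<comment> \<open>Equal images have equal parents. The induction hypothesis then makes
    \<open>v\<close> and \<open>w\<close> siblings, and siblings are separated by
    \<open>g\<close>.\<close>
  have "v < n \<Longrightarrow> w < n \<Longrightarrow> f v = f w \<Longrightarrow> v = w" for v w
  proof (induction v arbitrary: w rule: less_induct)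
    case (less v)
    show ?case
    proof (cases "v = 0 \<or> w = 0")
      case True then show ?thesis using less.prems emb_f[of v] emb_f[of w] f0 by auto
    next
      case False
      then have p: "par v < v" "par w < w" using less.prems G.par_less by auto
      have "f (par v) = f (par w)" using emb_f[of v] emb_f[of w] less.prems False by auto
      then have pe: "par v = par w" using less.IH[OF p(1), of "par w"] p less.prems by simp
      have "inj_on (g (par v) (f (par v))) (kids n par (par v))"
        using g[of "par v" "f (par v)"] emb_f[of "par v"] p less.prems by auto
      moreover have "g (par v) (f (par v)) v = g (par v) (f (par v)) w"
        using fS[of v] fS[of w] False less.prems pe by simp
      moreover have "v \<in> kids n par (par v)" "w \<in> kids n par (par v)"
        using False less.prems pe by (auto simp: kids_iff)
      ultimately show ?thesis by (auto dest: inj_onD)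
    qed
  qed
  then have "inj_on f {..<n}" by (auto simp: inj_on_def)
  then have "rooted_map f" using emb_f f0 by (auto simp: rooted_map_def)
  then show ?thesis by blast
qed

theorem rooted_iff_emb: "rooted_subtree_iso G.gr H.gr \<longleftrightarrow> emb (\<tau> 0) (\<sigma> 0)"
proof
  assume "rooted_subtree_iso G.gr H.gr"
  then obtain S :: "nat graph" and f where S: "subtree S H.gr" "graph_iso f G.gr S" "f 0 = 0"
    by (auto simp: rooted_subtree_iso_def)
  have "rooted_map f" by (rule rooted_mapI[OF iso_imp_hom(1,2)[OF S(1,2)] S(3) iso_imp_hom(3)[OF S(1,2)]])
  then show "emb (\<tau> 0) (\<sigma> 0)" using rooted_map_imp_emb[of f 0] G.pos by (auto simp: rooted_map_def)
qed (use emb_imp_rooted_map rooted_map_imp_iso in blast)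

text \<open>A node that is mapped downwards takes its whole subtree along, including a longest path,
  and all of it must fit below the root of \<open>H\<close>.\<close>

lemma downward_level:
  assumes inj: "inj_on f {..<n}" and hom: "\<And>u v. (u, v) \<in> adj G.gr \<Longrightarrow> (f u, f v) \<in> adj H.gr"
  shows "0 < v \<Longrightarrow> v < n \<Longrightarrow> 0 < f v \<Longrightarrow> f v < m \<Longrightarrow> q (f v) = f (par v) \<Longrightarrow>
    level H.gr (f v) + height (\<tau> v) \<le> height (\<sigma> 0)"
proof (induction "height (\<tau> v)" arbitrary: v rule: less_induct)
  case less
  have step: "level H.gr (f v) + Suc (height (\<tau> w)) \<le> height (\<sigma> 0)" if w: "w \<in> kids n par v" for w
  proof -
    have d: "0 < f w \<and> f w < m \<and> q (f w) = f v"
      by (rule downward[OF inj hom _ _ _ _ w]) (use less.prems in auto)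
    have "level H.gr (f w) + height (\<tau> w) \<le> height (\<sigma> 0)"
      by (rule less.hyps) (use d w G.height_kid less.prems in \<open>auto simp: kids_iff\<close>)
    then show ?thesis using H.level_Suc[of "f w"] d by simp
  qed
  have l: "level H.gr (f v) < height (\<sigma> 0)" using H.level_less_height less.prems by auto
  from G.shape[OF less.prems(2)] show ?case
    using step l by (auto simp: max_def)
qed

text \<open>If the root of \<open>G\<close> is not mapped to the root of \<open>H\<close>, then one of its two children is mapped
  downwards, and with it a path too long for \<open>H\<close>.\<close>

theorem unrooted_iff_rooted:
  assumes \<tau>0: "\<tau> 0 = Node l r" "Suc (height l) = height (\<sigma> 0)" "Suc (height r) = height (\<sigma> 0)"
    and ne: "l \<noteq> Empty" "r \<noteq> Empty"
  shows "unrooted_subtree_iso G.gr H.gr \<longleftrightarrow> rooted_subtree_iso G.gr H.gr"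
proof
  assume "unrooted_subtree_iso G.gr H.gr"
  then obtain S :: "nat graph" and f where S: "subtree S H.gr" "graph_iso f G.gr S"
    by (auto simp: unrooted_subtree_iso_def)
  note hom = iso_imp_hom[OF S]
  from G.shape[OF G.pos] ne \<tau>0 obtain w w' where w: "w \<noteq> w'" "kids n par 0 = {w, w'}"
    "height (\<tau> w) + 1 = height (\<sigma> 0)" "height (\<tau> w') + 1 = height (\<sigma> 0)"
    by auto
  have "f 0 = 0"
  proof (rule ccontr)
    assume f0: "f 0 \<noteq> 0"
    have fm: "f 0 < m" using hom(2) G.pos by auto
    have wn: "0 < w" "w < n" "par w = 0" "0 < w'" "w' < n" "par w' = 0"
      using w(2) by (auto simp: kids_def)
    have "(f 0, f w) \<in> adj H.gr" "(f 0, f w') \<in> adj H.gr"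
      by (rule hom(3); use wn in \<open>auto simp: G.adj_iff\<close>)+
    moreover have "f w \<noteq> f w'" using inj_onD[OF hom(1), of w w'] wn w by auto
    \<comment> \<open>Only one neighbour of \<open>f 0\<close> is its parent, so at most one of the
      two children can be mapped upwards.\<close>
    ultimately have "\<exists>v\<in>{w, w'}. 0 < f v \<and> f v < m \<and> q (f v) = f 0"
      by (auto simp: H.adj_iff)
    then obtain v where v: "v \<in> {w, w'}" "0 < f v" "f v < m" "q (f v) = f 0" by blast
    have "level H.gr (f v) + height (\<tau> v) \<le> height (\<sigma> 0)"
      by (rule downward_level[OF hom(1,3)]) (use v wn in auto)
    \<comment> \<open>The image lies at level at least 2, whereas the height of
      \<open>\<tau> v\<close> is only one less than that of \<open>H\<close>.\<close>
    moreover have "level H.gr (f v) = Suc (Suc (level H.gr (q (f 0))))"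
      using H.level_Suc[of "f v"] H.level_Suc[of "f 0"] v f0 fm by simp
    ultimately show False using v w by auto
  qed
  then show "rooted_subtree_iso G.gr H.gr" using S by (auto simp: rooted_subtree_iso_def)
qed (auto simp: rooted_subtree_iso_def unrooted_subtree_iso_def)

end

section \<open>The gadgets\<close>

definition lf :: btree where
  "lf = Node Empty Empty"

primrec path :: "nat \<Rightarrow> btree \<Rightarrow> btree" where
  "path 0 t = t"
| "path (Suc k) t = Node (path k t) Empty"

text \<open>The leaves of \<open>ctree d j g 0\<close> sit at the addresses \<open>i * d\<close> with \<open>i < 2 ^ j\<close>, which the program
  can thus compute without multiplication.\<close>

primrec ctree :: "nat \<Rightarrow> nat \<Rightarrow> (nat \<Rightarrow> btree) \<Rightarrow> nat \<Rightarrow> btree" where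
  "ctree d 0 g x = g x"
| "ctree d (Suc j) g x = Node (ctree d j g (2 * x)) (ctree d j g (2 * x + d))"

primrec utree :: "nat \<Rightarrow> btree \<Rightarrow> btree" where
  "utree 0 u = u"
| "utree (Suc j) u = Node (utree j u) (utree j u)"

text \<open>A \<open>utree\<close> with one leaf replaced by \<open>s\<close>. As children are
  unordered, the position of this leaf does not matter.\<close>

primrec spine :: "nat \<Rightarrow> btree \<Rightarrow> btree \<Rightarrow> btree" where
  "spine 0 u s = s"
| "spine (Suc j) u s = Node (spine j u s) (utree j u)"

text \<open>The extra leaf below the second child keeps an embedding from swapping the two children.\<close>

definition and_node :: "btree \<Rightarrow> btree \<Rightarrow> btree" where
  "and_node a b = Node (Node a Empty) (Node b lf)"

text \<open>The flag \<open>h\<close> selects the gadget of \<open>H\<close>.  The number \<open>m\<close> is a prefix of an index read in base 4: each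
  digit consists of an OR coordinate and an AND coordinate, and the gadget of \<open>G\<close> only looks at
  indices all of whose OR coordinates are 0.\<close>

primrec gad :: "bool \<Rightarrow> (nat \<Rightarrow> bool) \<Rightarrow> nat \<Rightarrow> nat \<Rightarrow> btree" where
  "gad h f 0 m = Node lf (if f m = h then Empty else lf)"
| "gad h f (Suc j) m =
     Node (and_node (gad h f j (4 * m)) (gad h f j (4 * m + 1)))
       (if h then and_node (gad h f j (4 * m + 2)) (gad h f j (4 * m + 3)) else Empty)"

text \<open>The negated product as a game: each round chooses the OR coordinate in the index for
  \<open>g\<close>, while the index for \<open>f\<close> keeps it at 0, and must then win for both
  values of the AND coordinate.\<close>

primrec win :: "(nat \<Rightarrow> bool) \<Rightarrow> (nat \<Rightarrow> bool) \<Rightarrow> nat \<Rightarrow> nat \<Rightarrow> nat \<Rightarrow> bool" where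
  "win f g 0 m m' \<longleftrightarrow> \<not> (f m \<and> g m')"
| "win f g (Suc j) m m' \<longleftrightarrow>
     win f g j (4 * m) (4 * m') \<and> win f g j (4 * m + 1) (4 * m' + 1) \<or>
     win f g j (4 * m) (4 * m' + 2) \<and> win f g j (4 * m + 1) (4 * m' + 3)"

lemma emb_Empty [simp]: "emb t Empty \<longleftrightarrow> t = Empty"
  by (cases t) auto

lemma gad_nonempty [simp]: "gad h f j m \<noteq> Empty"
  by (cases j) auto

lemma not_emb_gad_lf [simp]: "\<not> emb (gad h f j m) lf"
  by (cases j) (auto simp: lf_def and_node_def)

lemma emb_lf [simp]: "emb lf t \<longleftrightarrow> t \<noteq> Empty"
  by (cases t) (auto simp: lf_def)

lemma lf_nonempty [simp]: "lf \<noteq> Empty"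
  by (simp add: lf_def)

text \<open>Swapping the two children fails because \<open>Node b lf\<close> has two children and
  \<open>Node a' Empty\<close> only one. The assumption \<open>\<not> emb b lf\<close> excludes
  exchanging \<open>b\<close> with the leaf inside the second child.\<close>

lemma emb_and_node:
  assumes "a \<noteq> Empty" "b \<noteq> Empty" "\<not> emb b lf" "a' \<noteq> Empty" "b' \<noteq> Empty"
  shows "emb (and_node a b) (and_node a' b') \<longleftrightarrow> emb a a' \<and> emb b b'"
  using assms by (auto simp: and_node_def)

text \<open>At the bottom a bit 1 of \<open>f\<close> demands two leaves and a bit 1 of
  \<open>g\<close> offers only one, so exactly the pair of two ones fails. At an OR node the single
  child on the side of \<open>f\<close> may enter either child on the side of
  \<open>g\<close>.\<close>

lemma emb_gad: "emb (gad False f j m) (gad True g j m') \<longleftrightarrow> win f g j m m'"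
  by (induction j arbitrary: m m') (simp_all add: emb_and_node)

text \<open>This makes the gadget of an all-zero tensor universal.\<close>

lemma win_empty: "win f (\<lambda>_. False) j m m'"
  by (induction j arbitrary: m m') auto

lemma path_nonempty [simp]: "t \<noteq> Empty \<Longrightarrow> path k t \<noteq> Empty"
  by (cases k) auto

lemma ctree_nonempty: "(\<And>x. g x \<noteq> Empty) \<Longrightarrow> ctree d j g x \<noteq> Empty"
  by (cases j) auto

lemma path_add: "path (a + b) t = path a (path b t)"
  by (induction a) auto

lemma emb_path: "a \<noteq> Empty \<Longrightarrow> emb (path k a) (path k b) \<longleftrightarrow> emb a b"
  by (induction k) auto

lemma ex_less_2_times: "(\<exists>i<2 * (k::nat). P i) \<longleftrightarrow> (\<exists>i<k. P i) \<or> (\<exists>i<k. P (k + i))"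
proof
  assume "\<exists>i<2 * k. P i"
  then obtain i where i: "i < 2 * k" "P i" by blast
  show "(\<exists>i<k. P i) \<or> (\<exists>i<k. P (k + i))"
  proof (cases "i < k")
    case False
    then show ?thesis using i by (intro disjI2 exI[of _ "i - k"]) auto
  qed (use i in blast)
next
  assume "(\<exists>i<k. P i) \<or> (\<exists>i<k. P (k + i))"
  then show "\<exists>i<2 * k. P i"
  proof
    assume "\<exists>i<k. P (k + i)"
    then obtain i where "i < k" "P (k + i)" by blast
    then show ?thesis by (intro exI[of _ "k + i"]) auto
  next
    assume "\<exists>i<k. P i"
    then obtain i where "i < k" "P i" by blast
    then show ?thesis by (intro exI[of _ i]) auto
  qed
qed

text \<open>The left subtree holds the lower half of the leaf numbers; adding \<open>d\<close> to
  the base shifts all \<open>2 ^ j\<close> addresses by \<open>2 ^ j * d\<close>.\<close>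

lemma ex_ctree_leaf:
  "(\<exists>i<2 ^ Suc j. P (2 ^ Suc j * x + i * d :: nat)) \<longleftrightarrow>
   (\<exists>i<2 ^ j. P (2 ^ j * (2 * x) + i * d)) \<or> (\<exists>i<2 ^ j. P (2 ^ j * (2 * x + d) + i * d))"
  unfolding power_Suc ex_less_2_times by (simp add: algebra_simps)

lemma emb_path_ctree:
  assumes "a \<noteq> Empty"
  shows "emb (path j a) (ctree d j g x) \<longleftrightarrow> (\<exists>i<2 ^ j. emb a (g (2 ^ j * x + i * d)))"
proof (induction j arbitrary: x)
  case (Suc j)
  show ?case unfolding ex_ctree_leaf[of j "\<lambda>v. emb a (g v)"] using Suc assms by simp
qed simp

lemma emb_ctree_utree:
  "(\<And>x. emb (g x) u) \<Longrightarrow> emb (ctree d j g x) (utree j u)"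
  by (induction j arbitrary: x) auto

text \<open>All leaves fit into \<open>u\<close>, so only the leaf sent to \<open>s\<close> matters,
  and swapping children along the spine can send any leaf there.\<close>

lemma emb_ctree_spine:
  assumes "\<And>x. emb (g x) u"
  shows "emb (ctree d j g x) (spine j u s) \<longleftrightarrow> (\<exists>i<2 ^ j. emb (g (2 ^ j * x + i * d)) s)"
proof (induction j arbitrary: x)
  case (Suc j)
  show ?case unfolding ex_ctree_leaf[of j "\<lambda>v. emb (g v) s"]
    using Suc emb_ctree_utree[of g u, OF assms] by auto
qed simp

text \<open>Leaves without a tensor of their own repeat the tensor at address 0.\<close>

definition clip :: "nat \<Rightarrow> nat \<Rightarrow> nat" where
  "clip z x = (if x < z then x else 0)"

definition entry :: "(nat \<Rightarrow> nat) \<Rightarrow> nat \<Rightarrow> nat \<Rightarrow> bool" where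
  "entry g x m \<longleftrightarrow> 0 < g (x + m)"

text \<open>The 3 in \<open>n + 3\<close> pays for the nodes of \<open>H_tree\<close> at which the
  local rule changes the kind of a label: the end of the spine, a leaf of the second complete tree,
  and the path node above a gadget.\<close>

definition G_tree :: "nat \<Rightarrow> nat \<Rightarrow> nat \<Rightarrow> nat \<Rightarrow> (nat \<Rightarrow> nat) \<Rightarrow> btree" where
  "G_tree n y d z g = ctree d n (\<lambda>x. path (n + 3) (gad False (entry g (clip z x)) y 0)) 0"

text \<open>The array \<open>g\<close> is 0 from the address \<open>z\<close> on, so the gadget based there is the universal one.\<close>

definition H_tree :: "nat \<Rightarrow> nat \<Rightarrow> nat \<Rightarrow> nat \<Rightarrow> (nat \<Rightarrow> nat) \<Rightarrow> btree" where
  "H_tree n y d z g =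
     spine n (path (n + 3) (gad True (entry g z) y 0))
       (path 1 (ctree d n (\<lambda>x. path 2 (gad True (entry g (clip z x)) y 0)) 0))"

lemma emb_G_H:
  assumes "\<And>m. g (z + m) = 0"
  shows "emb (G_tree n y d z f) (H_tree n y d z g) \<longleftrightarrow>
    (\<exists>i<2 ^ n. \<exists>i'<2 ^ n. win (entry f (clip z (i * d))) (entry g (clip z (i' * d))) y 0 0)"
proof -
  have e: "entry g z = (\<lambda>_. False)" using assms by (auto simp: entry_def)
  have *: "emb (path (n + 3) a) (path 1 (ctree d n (\<lambda>x. path 2 (b x)) 0)) \<longleftrightarrow>
      (\<exists>i<2 ^ n. emb a (b (i * d)))" if "a \<noteq> Empty" for a b
  proof -
    \<comment> \<open>The split \<open>n + 3 = 1 + n + 2\<close> follows \<open>H\<close>: the edge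
      above the second complete tree, the \<open>n\<close> edges that choose one of its leaves, and
      the two edges below that leaf.\<close>
    have "path (n + 3) a = path 1 (path n (path 2 a))"
      by (simp only: path_add[symmetric]) (simp add: numeral_3_eq_3)
    then show ?thesis using that by (simp add: emb_path_ctree emb_path del: path.simps)
  qed
  show ?thesis unfolding G_tree_def H_tree_def e
    by (subst emb_ctree_spine) (simp_all add: emb_path emb_gad win_empty *[unfolded One_nat_def] del: path.simps)
qed

section \<open>Heights and numbers of nodes\<close>

lemma height_gad: "height (gad h f j m) = 3 * j + 2"
  by (induction j arbitrary: m) (auto simp: lf_def and_node_def)

lemma height_path: "height (path k t) = k + height t"
  by (induction k) auto

lemma height_ctree: "(\<And>x. height (g x) = c) \<Longrightarrow> height (ctree d j g x) = j + c"
  by (induction j arbitrary: x) auto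

lemma height_utree: "height (utree j u) = j + height u"
  by (induction j) auto

lemma height_spine: "height s = height u \<Longrightarrow> height (spine j u s) = j + height u"
  by (induction j) (auto simp: height_utree)

lemma height_G_tree: "height (G_tree n y d z g) = 2 * n + 3 * y + 5"
  unfolding G_tree_def
  by (simp add: height_path height_gad height_ctree[where c = "n + 3 * y + 5"] del: path.simps)

lemma height_H_tree: "height (H_tree n y d z g) = 2 * n + 3 * y + 5"
  unfolding H_tree_def
  by (subst height_spine) (simp_all add: height_path height_gad height_ctree[where c = "3 * y + 4"] del: path.simps)

lemma G_tree_root:
  assumes "0 < n"
  obtains l r where "G_tree n y d z g = Node l r" "l \<noteq> Empty" "r \<noteq> Empty"
    "height l = 2 * n + 3 * y + 4" "height r = 2 * n + 3 * y + 4"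
proof -
  obtain j where j: "n = Suc j" using assms by (cases n) auto
  show ?thesis
  proof (rule that)
    show "G_tree n y d z g = Node
      (ctree d j (\<lambda>x. path (n + 3) (gad False (entry g (clip z x)) y 0)) 0)
      (ctree d j (\<lambda>x. path (n + 3) (gad False (entry g (clip z x)) y 0)) d)"
      by (simp add: G_tree_def j)
  qed (simp_all add: ctree_nonempty height_ctree[where c = "n + 3 * y + 5"] height_path height_gad, simp_all add: j)
qed

text \<open>The offset 3 solves the recurrence: a full OR node with its two AND nodes adds 9 nodes
  to four subgadgets, and \<open>9 + 3 = 4 * 3\<close>.\<close>

lemma nodes_gad: "nodes (gad h f j m) + 3 \<le> 6 * 4 ^ j"
proof (induction j arbitrary: m)
  case (Suc j)
  show ?case using Suc[of "4 * m"] Suc[of "4 * m + 1"] Suc[of "4 * m + 2"] Suc[of "4 * m + 3"]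
    by (cases h) (simp_all add: lf_def and_node_def)
qed (simp add: lf_def)

lemma nodes_path: "nodes (path k t) = k + nodes t"
  by (induction k) auto

lemma nodes_ctree: "(\<And>x. nodes (g x) \<le> c) \<Longrightarrow> nodes (ctree d j g x) + 1 \<le> 2 ^ j * (c + 1)"
proof (induction j arbitrary: x)
  case (Suc j)
  show ?case using Suc.IH[OF Suc.prems, of "2 * x"] Suc.IH[OF Suc.prems, of "2 * x + d"] by simp
qed simp

lemma nodes_utree: "nodes (utree j u) + 1 \<le> 2 ^ j * (nodes u + 1)"
  by (induction j) auto

lemma nodes_spine: "nodes (spine j u s) + (nodes u + 1) \<le> 2 ^ j * (nodes u + 1) + nodes s"
proof (induction j)
  case (Suc j)
  show ?case using Suc nodes_utree[of j u] by simp
qed simp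

lemma nodes_G_tree: "nodes (G_tree n y d z g) \<le> 2 ^ n * (n + 8 + 12 * 4 ^ y)"
proof -
  have "nodes (G_tree n y d z g) + 1 \<le> 2 ^ n * (n + 3 + 6 * 4 ^ y + 1)"
    unfolding G_tree_def
  proof (rule nodes_ctree)
    show "nodes (path (n + 3) (gad False (entry g (clip z x)) y 0)) \<le> n + 3 + 6 * 4 ^ y" for x
      using nodes_gad[of False "entry g (clip z x)" y 0] unfolding nodes_path by simp
  qed
  also have "\<dots> \<le> 2 ^ n * (n + 8 + 12 * 4 ^ y)" by (rule mult_le_mono2) simp
  finally show ?thesis by simp
qed

lemma nodes_H_tree: "nodes (H_tree n y d z g) \<le> 2 ^ n * (n + 8 + 12 * 4 ^ y)"
proof -
  define u where "u = path (n + 3) (gad True (entry g z) y 0)"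
  define s where "s = ctree d n (\<lambda>x. path 2 (gad True (entry g (clip z x)) y 0)) 0"
  have u: "nodes u \<le> n + 6 * 4 ^ y"
    using nodes_gad[of True "entry g z" y 0] unfolding u_def nodes_path by simp
  have s: "nodes s + 1 \<le> 2 ^ n * (2 + 6 * 4 ^ y + 1)"
    unfolding s_def
  proof (rule nodes_ctree)
    show "nodes (path 2 (gad True (entry g (clip z x)) y 0)) \<le> 2 + 6 * 4 ^ y" for x
      using nodes_gad[of True "entry g (clip z x)" y 0] unfolding nodes_path by simp
  qed
  have "nodes (H_tree n y d z g) \<le> 2 ^ n * (nodes u + 1) + nodes (path 1 s)"
    using nodes_spine[of n u "path 1 s"] unfolding H_tree_def u_def s_def by linarith
  also have "\<dots> \<le> 2 ^ n * (n + 6 * 4 ^ y + 1) + 2 ^ n * (2 + 6 * 4 ^ y + 1)"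
    by (rule add_mono) (use u s in \<open>simp_all add: nodes_path del: path.simps\<close>)
  also have "\<dots> \<le> 2 ^ n * (n + 8 + 12 * 4 ^ y)" by (simp add: algebra_simps)
  finally show ?thesis .
qed

section \<open>From gadgets to the alternating product\<close>

text \<open>Clears the OR coordinates, which are the upper bits of the digits in base 4.\<close>

fun canon :: "nat \<Rightarrow> nat" where
  "canon m = (if m = 0 then 0 else 4 * canon (m div 4) + m mod 2)"

declare canon.simps [simp del]

lemma canon_0 [simp]: "canon 0 = 0"
  by (simp add: canon.simps)

lemma canon_digits: "canon m = 4 * canon (m div 4) + m mod 2"
  by (cases "m = 0") (simp_all add: canon.simps[of m])

lemma canon_4:
  "canon (4 * m) = 4 * canon m" "canon (4 * m + 1) = 4 * canon m + 1"
  "canon (4 * m + 2) = 4 * canon m" "canon (4 * m + 3) = 4 * canon m + 1"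
proof -
  have "(4 * m + 1) mod 2 = 1" "(4 * m + 2) mod 2 = 0" "(4 * m + 3) mod 2 = 1" "4 * m mod 2 = 0"
    by presburger+
  moreover have "4 * m div 4 = m" "(4 * m + 1) div 4 = m" "(4 * m + 2) div 4 = m" "(4 * m + 3) div 4 = m"
    by presburger+
  ultimately show "canon (4 * m) = 4 * canon m" "canon (4 * m + 1) = 4 * canon m + 1"
    "canon (4 * m + 2) = 4 * canon m" "canon (4 * m + 3) = 4 * canon m + 1"
    by (metis canon_digits add_0_right)+
qed

lemma canon_le: "canon m \<le> m"
proof (induction m rule: less_induct)
  case (less m)
  show ?case
  proof (cases "m = 0")
    case False
    then have "canon (m div 4) \<le> m div 4" by (intro less) simp
    then show ?thesis using canon_digits[of m] by presburger
  qed simp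
qed

text \<open>Clearing works digit by digit, so it commutes with dropping low digits; with
  \<open>odd_canon\<close> this shows that the AND coordinates survive.\<close>

lemma canon_div_4: "canon m div 4 ^ e = canon (m div 4 ^ e)"
proof (induction e arbitrary: m)
  case (Suc e)
  have "canon m div 4 = canon (m div 4)"
    using canon_digits[of m] by presburger
  then have "canon m div 4 ^ Suc e = canon (m div 4) div 4 ^ e"
    by (simp add: div_mult2_eq)
  then show ?case using Suc by (simp add: div_mult2_eq)
qed simp

lemma odd_canon: "odd (canon m) \<longleftrightarrow> odd m"
  using canon_digits[of m] by presburger

text \<open>Reads an index in binary behind the prefix \<open>m\<close>, as the recursion of
  \<open>alternate\<close> fixes one coordinate after the other.\<close>

primrec idx :: "nat \<Rightarrow> bool list \<Rightarrow> nat" where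
  "idx m [] = m"
| "idx m (b # i) = idx (2 * m + of_bool b) i"

lemma alternate_cong:
  "(\<And>i. length i = n \<Longrightarrow> f i = g i) \<Longrightarrow> alternate q n f = alternate q n g"
proof (induction n arbitrary: q f g)
  case (Suc n)
  have "alternate p n (\<lambda>i. f (b # i)) = alternate p n (\<lambda>i. g (b # i))" for p b
    by (rule Suc.IH) (simp add: Suc.prems)
  then show ?case by (cases q) auto
qed simp

lemma idx_div: "idx m i div 2 ^ length i = m"
proof (induction i arbitrary: m)
  case (Cons b i)
  have "idx m (b # i) div 2 ^ length (b # i) = (idx (2 * m + of_bool b) i div 2 ^ length i) div 2"
    by (simp add: div_mult2_eq[symmetric] mult.commute)
  then show ?case by (simp add: Cons)
qed simp

lemma idx_bound: "idx 0 i < 2 ^ length i"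
  using idx_div[of 0 i] by (simp add: div_eq_0_iff)

lemma even_idx_div: "k < length i \<Longrightarrow> even (idx m i div 2 ^ (length i - Suc k)) \<longleftrightarrow> \<not> i ! k"
proof (induction i arbitrary: m k)
  case (Cons b i)
  show ?case
  proof (cases k)
    case 0 then show ?thesis by (simp add: idx_div)
  next
    case (Suc k')
    then show ?thesis using Cons.IH[of k' "2 * m + of_bool b"] Cons.prems by simp
  qed
qed simp

lemma nth_index_idx: "length i = t \<Longrightarrow> nth_index t (idx 0 i) = i"
  unfolding nth_index_def by (rule nth_equalityI) (auto simp: even_idx_div)

text \<open>\<open>win\<close> clears the OR coordinates for \<open>f\<close>, so its first index
  remains the \<open>canon\<close> of the second. Invariance is applied only once the index is
  complete; the bound on \<open>m\<close> keeps all completions of the prefix below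
  \<open>d\<close>.\<close>

lemma win_alternate:
  assumes "\<And>k. k < d \<Longrightarrow> f k = f (canon k)"
  shows "(m + 1) * 4 ^ j \<le> d \<Longrightarrow>
    win f g j (canon m) m \<longleftrightarrow> \<not> alternate True (2 * j) (\<lambda>i. f (idx m i) \<and> g (idx m i))"
proof (induction j arbitrary: m)
  case 0
  then show ?case using assms[of m] by simp
next
  case (Suc j)
  have b: "(4 * m + e + 1) * 4 ^ j \<le> d" if "e < 4" for e
  proof -
    have "(4 * m + e + 1) * 4 ^ j \<le> ((m + 1) * 4) * 4 ^ j"
      by (rule mult_le_mono1) (use that in simp)
    also have "\<dots> \<le> d" using Suc.prems by (simp only: mult.assoc power_Suc)
    finally show ?thesis .
  qed
  define R where "R k \<longleftrightarrow> alternate True (2 * j) (\<lambda>i. f (idx k i) \<and> g (idx k i))" for k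
  have IH: "win f g j (4 * canon m) (4 * m) \<longleftrightarrow> \<not> R (4 * m)"
    "win f g j (4 * canon m + 1) (4 * m + 1) \<longleftrightarrow> \<not> R (4 * m + 1)"
    "win f g j (4 * canon m) (4 * m + 2) \<longleftrightarrow> \<not> R (4 * m + 2)"
    "win f g j (4 * canon m + 1) (4 * m + 3) \<longleftrightarrow> \<not> R (4 * m + 3)"
    using Suc.IH[OF b[of 0]] Suc.IH[OF b[of 1]] Suc.IH[OF b[of 2]] Suc.IH[OF b[of 3]]
    by (simp_all only: canon_4 R_def add_0_right)
  have m: "2 * (2 * m + of_bool False) + of_bool False = 4 * m"
    "2 * (2 * m + of_bool False) + of_bool True = 4 * m + 1"
    "2 * (2 * m + of_bool True) + of_bool False = 4 * m + 2"
    "2 * (2 * m + of_bool True) + of_bool True = 4 * m + 3" by simp_all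
  have "alternate True (2 * Suc j) (\<lambda>i. f (idx m i) \<and> g (idx m i)) \<longleftrightarrow>
      (\<forall>b. \<exists>c. R (2 * (2 * m + of_bool b) + of_bool c))"
    by (simp add: R_def)
  also have "\<dots> \<longleftrightarrow> (R (4 * m) \<or> R (4 * m + 1)) \<and> (R (4 * m + 2) \<or> R (4 * m + 3))"
    unfolding all_bool_eq ex_bool_eq m by blast
  finally show ?case unfolding win.simps IH by blast
qed

lemma tensor_array_entry:
  assumes "i < length us" "m < 2 ^ t"
  shows "tensor_array t us (i * 2 ^ t + m) = of_bool ((us ! i) (nth_index t m))"
proof -
  have "i * 2 ^ t + m < Suc i * 2 ^ t" using assms by simp
  also have "\<dots> \<le> length us * 2 ^ t" using assms by (intro mult_le_mono1) simp
  finally show ?thesis using assms by (simp add: tensor_array_def div_add1_eq)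
qed

text \<open>The test made by the program: it follows from \<open>\<and>\<close>-invariance and suffices for the gadgets.\<close>

definition canonical :: "nat \<Rightarrow> nat \<Rightarrow> (nat \<Rightarrow> nat) \<Rightarrow> bool" where
  "canonical N d g \<longleftrightarrow> (\<forall>i<N. \<forall>m<d. g (i * d + m) = g (i * d + canon m))"

text \<open>For even \<open>t\<close> an odd list position \<open>k\<close> has weight
  \<open>2 ^ (t - 1 - k)\<close> with an even exponent. It is thus the lower bit of a base 4 digit,
  which \<open>canon\<close> preserves.\<close>

lemma and_invariant_canonical:
  assumes t: "even t" and inv: "\<And>u. u \<in> set us \<Longrightarrow> and_invariant t u"
  shows "canonical (length us) (2 ^ t) (tensor_array t us)"
  unfolding canonical_def
proof (intro allI impI)
  fix i m assume i: "i < length us" and m: "m < (2::nat) ^ t"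
  have c: "canon m < 2 ^ t" using canon_le[of m] m by simp
  have "nth_index t m ! k = nth_index t (canon m) ! k" if "k < t" "odd k" for k
  proof -
    have "even (t - 1 - k)" using t that by simp
    then obtain e where "t - 1 - k = 2 * e" by (elim evenE)
    then have p: "(2::nat) ^ (t - 1 - k) = 4 ^ e" by (simp add: power_mult)
    show ?thesis using that by (simp add: nth_index_def p[simplified] canon_div_4 odd_canon)
  qed
  then have "(us ! i) (nth_index t m) = (us ! i) (nth_index t (canon m))"
    using inv[of "us ! i"] i unfolding and_invariant_def indices_def by (auto simp: nth_index_def)
  then show "tensor_array t us (i * 2 ^ t + m) = tensor_array t us (i * 2 ^ t + canon m)"
    by (simp add: tensor_array_entry i m c)
qed

lemma win_p_alt:
  assumes t: "t = 2 * y" and c: "canonical (length us) (2 ^ t) (tensor_array t us)"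
    and i: "i < length us" and j: "j < length vs"
  shows "win (entry (tensor_array t us) (i * 2 ^ t)) (entry (tensor_array t vs) (j * 2 ^ t)) y 0 0
    \<longleftrightarrow> \<not> p_alt t (us ! i) (vs ! j)"
proof -
  let ?f = "entry (tensor_array t us) (i * 2 ^ t)" and ?g = "entry (tensor_array t vs) (j * 2 ^ t)"
  have "win ?f ?g y (canon 0) 0 \<longleftrightarrow> \<not> alternate True (2 * y) (\<lambda>l. ?f (idx 0 l) \<and> ?g (idx 0 l))"
  proof (rule win_alternate)
    show "?f k = ?f (canon k)" if "k < 2 ^ t" for k
      using c i that by (simp add: canonical_def entry_def)
    show "(0 + 1) * 4 ^ y \<le> (2::nat) ^ t" by (simp add: t power_mult)
  qed
  also have "alternate True (2 * y) (\<lambda>l. ?f (idx 0 l) \<and> ?g (idx 0 l)) =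
      alternate True (2 * y) (\<lambda>l. (us ! i) l \<and> (vs ! j) l)"
  proof (rule alternate_cong)
    fix l :: "bool list" assume l: "length l = 2 * y"
    then have "idx 0 l < 2 ^ t" using idx_bound[of l] by (simp add: t)
    then show "(?f (idx 0 l) \<and> ?g (idx 0 l)) = ((us ! i) l \<and> (vs ! j) l)"
      using nth_index_idx[of l t] l i j by (simp add: entry_def tensor_array_entry t)
  qed
  finally show ?thesis by (simp add: p_alt_def t)
qed

lemma p_alt_commute: "p_alt t u v = p_alt t v u"
  by (simp add: p_alt_def conj_commute)

lemma emb_iff_p_alt:
  assumes t: "t = 2 * y" and c: "canonical N (2 ^ t) (tensor_array t us)"
    and N: "length us = N" "length vs = N" "1 \<le> N" "N \<le> 2 ^ n"
  shows "emb (G_tree n y (2 ^ t) (N * 2 ^ t) (tensor_array t us))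
             (H_tree n y (2 ^ t) (N * 2 ^ t) (tensor_array t vs)) \<longleftrightarrow>
    (\<exists>u\<in>set us. \<exists>v\<in>set vs. \<not> p_alt t u v)"
proof -
  \<comment> \<open>\<open>r\<close> is \<open>clip\<close> on tensor numbers. It maps the
    \<open>2 ^ n\<close> leaves onto the \<open>N\<close> tensors, so the padding does not affect
    existence.\<close>
  define r where "r i = (if i < N then i else 0)" for i
  have cl: "clip (N * 2 ^ t) (i * 2 ^ t) = r i * 2 ^ t" for i
    by (simp add: clip_def r_def)
  have r: "r i < N" for i using N by (auto simp: r_def)
  have ex: "(\<exists>i<2 ^ n. P (r i)) \<longleftrightarrow> (\<exists>i<N. P i)" for P
  proof
    assume "\<exists>i<N. P i"
    then obtain i where "i < N" "P i" by blast
    then show "\<exists>i<2 ^ n. P (r i)" using N by (intro exI[of _ i]) (auto simp: r_def)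
  qed (use r in blast)
  have "emb (G_tree n y (2 ^ t) (N * 2 ^ t) (tensor_array t us))
            (H_tree n y (2 ^ t) (N * 2 ^ t) (tensor_array t vs)) \<longleftrightarrow>
    (\<exists>i<2 ^ n. \<exists>j<2 ^ n. \<not> p_alt t (us ! r i) (vs ! r j))"
    by (subst emb_G_H) (simp_all add: tensor_array_def N cl win_p_alt[OF t] c r)
  also have "\<dots> \<longleftrightarrow> (\<exists>i<N. \<exists>j<N. \<not> p_alt t (us ! i) (vs ! j))"
    unfolding ex[of "\<lambda>j. \<not> p_alt t _ (vs ! j)"] ex[of "\<lambda>i. \<exists>j<N. \<not> p_alt t (us ! i) (vs ! j)"] ..
  also have "\<dots> \<longleftrightarrow> (\<exists>u\<in>set us. \<exists>v\<in>set vs. \<not> p_alt t u v)"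
    using N by (simp add: Bex_def in_set_conv_nth) metis
  finally show ?thesis .
qed

section \<open>Verifying word RAM programs\<close>

text \<open>Weakest preconditions for loop-free commands, including the word bound. A loop gets
  \<open>False\<close>, which makes \<open>vc_runs\<close> vacuous there; loops are left to
  \<open>runs_While\<close>.\<close>

fun vc :: "nat \<Rightarrow> com \<Rightarrow> (state \<Rightarrow> bool) \<Rightarrow> state \<Rightarrow> bool" where
  "vc W Skip Q s \<longleftrightarrow> Q s"
| "vc W (Put x i a) Q s \<longleftrightarrow>
     afits W i s \<and> afits W a s \<and> Q (s(x := (s x)(aval i s := aval a s)))"
| "vc W (Seq c d) Q s \<longleftrightarrow> vc W c (vc W d Q) s"
| "vc W (Cond b c d) Q s \<longleftrightarrow>
     bfits W b s \<and> (bval b s \<longrightarrow> vc W c Q s) \<and> (\<not> bval b s \<longrightarrow> vc W d Q s)"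
| "vc W (While b c) Q s \<longleftrightarrow> False"

primrec max_cost :: "com \<Rightarrow> nat" where
  "max_cost Skip = 1"
| "max_cost (Put x i a) = 1 + acost i + acost a"
| "max_cost (Seq c d) = max_cost c + max_cost d"
| "max_cost (Cond b c d) = 1 + bcost b + max (max_cost c) (max_cost d)"
| "max_cost (While b c) = 0"

definition runs :: "nat \<Rightarrow> com \<Rightarrow> state \<Rightarrow> nat \<Rightarrow> (state \<Rightarrow> bool) \<Rightarrow> bool" where
  "runs W c s C Q \<longleftrightarrow> (\<exists>T s'. exec W c s T s' \<and> T \<le> C \<and> Q s')"

lemma runs_mono: "runs W c s C Q \<Longrightarrow> C \<le> C' \<Longrightarrow> (\<And>s'. Q s' \<Longrightarrow> R s') \<Longrightarrow> runs W c s C' R"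
  by (force simp: runs_def)

lemma runs_Seq:
  assumes "runs W c s C Q" "\<And>s'. Q s' \<Longrightarrow> runs W d s' C' R"
  shows "runs W (Seq c d) s (C + C') R"
  using assms unfolding runs_def by (meson add_mono exec.Seq)

lemma runs_Cond:
  assumes "bfits W b s" "bval b s \<Longrightarrow> runs W c s C Q" "\<not> bval b s \<Longrightarrow> runs W d s C Q"
  shows "runs W (Cond b c d) s (1 + bcost b + C) Q"
proof (cases "bval b s")
  case True
  then obtain T s' where "exec W c s T s'" "T \<le> C" "Q s'" using assms(2) by (auto simp: runs_def)
  then show ?thesis using exec.CondTrue[OF assms(1) True, of c T s' d] unfolding runs_def
    by (intro exI[of _ "1 + bcost b + T"] exI[of _ s']) simp
next
  case False
  then obtain T s' where "exec W d s T s'" "T \<le> C" "Q s'" using assms(3) by (auto simp: runs_def)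
  then show ?thesis using exec.CondFalse[OF assms(1) False, of d T s' c] unfolding runs_def
    by (intro exI[of _ "1 + bcost b + T"] exI[of _ s']) simp
qed

lemma vc_runs: "vc W c Q s \<Longrightarrow> runs W c s (max_cost c) Q"
proof (induction c arbitrary: Q s)
  case Skip
  then show ?case using exec.Skip by (auto simp: runs_def)
next
  case (Put x i a)
  then show ?case using exec.Put[of W i s a x] unfolding runs_def by fastforce
next
  case (Seq c d)
  then show ?case by (auto intro!: runs_Seq[where Q = "vc W d Q"])
next
  case (Cond b c d)
  have "runs W (Cond b c d) s (1 + bcost b + max (max_cost c) (max_cost d)) Q"
    using Cond.prems Cond.IH(1)[THEN runs_mono] Cond.IH(2)[THEN runs_mono]
    by (intro runs_Cond) auto
  then show ?case by simp
qed simp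

lemma runs_While:
  assumes "\<And>i s. i < n \<Longrightarrow> I i s \<Longrightarrow> bfits W b s \<and> bval b s \<and> runs W c s C (I (Suc i))"
    and "\<And>s. I n s \<Longrightarrow> bfits W b s \<and> \<not> bval b s"
    and "I 0 s"
  shows "runs W (While b c) s (n * (1 + bcost b + C) + (1 + bcost b)) (I n)"
proof -
  have "k \<le> n \<Longrightarrow> I (n - k) s \<Longrightarrow> runs W (While b c) s (k * (1 + bcost b + C) + (1 + bcost b)) (I n)" for k s
  proof (induction k arbitrary: s)
    case 0
    then show ?case using exec.WhileFalse[of W b s c] assms(2)[of s] by (auto simp: runs_def)
  next
    case (Suc k)
    then have "bfits W b s" "bval b s" "runs W c s C (I (Suc (n - Suc k)))"
      using assms(1)[of "n - Suc k" s] by auto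
    moreover have "Suc (n - Suc k) = n - k" using Suc.prems by simp
    ultimately obtain T s' where 1: "exec W c s T s'" "T \<le> C" "I (n - k) s'"
      by (auto simp: runs_def)
    then obtain T' s'' where 2: "exec W (While b c) s' T' s''"
      "T' \<le> k * (1 + bcost b + C) + (1 + bcost b)" "I n s''"
      using Suc.IH[of s'] Suc.prems by (auto simp: runs_def)
    have "exec W (While b c) s (1 + bcost b + T + T') s''"
      by (rule exec.WhileTrue) fact+
    moreover have "1 + bcost b + T + T' \<le> Suc k * (1 + bcost b + C) + (1 + bcost b)"
      using 1 2 by simp
    ultimately show ?case using 2(3) unfolding runs_def by blast
  qed
  from this[of n s] show ?thesis using assms(3) by simp
qed

primrec writes :: "com \<Rightarrow> string set" where
  "writes Skip = {}"
| "writes (Put x i a) = {x}"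
| "writes (Seq c d) = writes c \<union> writes d"
| "writes (Cond b c d) = writes c \<union> writes d"
| "writes (While b c) = writes c"

lemma exec_writes: "exec W c s T s' \<Longrightarrow> x \<notin> writes c \<Longrightarrow> s' x = s x"
  by (induction rule: exec.induct) auto

text \<open>Lets the specification of a program mention only what it changes.\<close>

lemma runs_frame:
  "runs W c s C Q \<Longrightarrow> runs W c s C (\<lambda>s'. Q s' \<and> (\<forall>x. x \<notin> writes c \<longrightarrow> s' x = s x))"
  unfolding runs_def using exec_writes by blast

primrec reads :: "aexp \<Rightarrow> string set" where
  "reads (Num n) = {}"
| "reads (Get x a) = insert x (reads a)"
| "reads (Add a b) = reads a \<union> reads b"
| "reads (Sub a b) = reads a \<union> reads b"

lemma aval_reads: "(\<And>x. x \<in> reads a \<Longrightarrow> s x = s' x) \<Longrightarrow> aval a s = aval a s'"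
  by (induction a) auto

lemma afits_reads: "(\<And>x. x \<in> reads a \<Longrightarrow> s x = s' x) \<Longrightarrow> afits W a s \<longleftrightarrow> afits W a s'"
proof (induction a)
  case (Get x a)
  then have "aval a s = aval a s'" by (intro aval_reads) auto
  then show ?case using Get by auto
next
  case (Add a b)
  then have "aval a s = aval a s'" "aval b s = aval b s'" by (auto intro: aval_reads)
  then show ?case using Add by auto
qed auto

abbreviation V :: "string \<Rightarrow> aexp" where "V x \<equiv> Get x (Num 0)"
abbreviation assign :: "string \<Rightarrow> aexp \<Rightarrow> com" where "assign x a \<equiv> Put x (Num 0) a"

section \<open>Labels of the nodes\<close>

text \<open>A label \<open>(k, j, x, m)\<close> consists of a kind \<open>k\<close>, a number \<open>j\<close> of levels to go, a base address \<open>x\<close> and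
  an index prefix \<open>m\<close>.  The kinds are: 0 a leaf; 1 an OR node, 2 an AND node, 3 and 4 the first and the
  second child of an AND node; 5 a path leading to a gadget; 6 a \<open>ctree\<close>; 7 a \<open>utree\<close>; 8 a \<open>spine\<close>.\<close>

type_synonym label = "nat \<times> nat \<times> nat \<times> nat"

definition labs :: "state \<Rightarrow> nat \<Rightarrow> label" where
  "labs s v = (s ''k'' v, s ''j'' v, s ''x'' v, s ''m'' v)"

text \<open>Cell \<open>l\<close> is the end of the queue and cell \<open>h\<close> its head, the
  node whose children are being written. The position in the queue is the number of the
  node.\<close>

definition emit :: "string \<Rightarrow> aexp \<Rightarrow> aexp \<Rightarrow> aexp \<Rightarrow> aexp \<Rightarrow> com" where
  "emit p a b c d =
     Seq (Put ''k'' (V ''l'') a) (Seq (Put ''j'' (V ''l'') b) (Seq (Put ''x'' (V ''l'') c)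
     (Seq (Put ''m'' (V ''l'') d) (Seq (Put p (V ''l'') (V ''h''))
     (assign ''l'' (Add (V ''l'') (Num 1)))))))"

definition emitted :: "string \<Rightarrow> label \<Rightarrow> state \<Rightarrow> state" where
  "emitted p = (\<lambda>(a, b, c, d) s. s(
     ''k'' := (s ''k'')(s ''l'' 0 := a), ''j'' := (s ''j'')(s ''l'' 0 := b),
     ''x'' := (s ''x'')(s ''l'' 0 := c), ''m'' := (s ''m'')(s ''l'' 0 := d),
     p := (s p)(s ''l'' 0 := s ''h'' 0), ''l'' := (s ''l'')(0 := s ''l'' 0 + 1)))"

definition scratch :: "string set" where
  "scratch = {''k'', ''j'', ''x'', ''m'', ''l'', ''h'', ''u'', ''q'', ''r'', ''s''}"

text \<open>The fields are written one after the other. As the four expressions read none of the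
  cells written, they can all be evaluated in the initial state.\<close>

lemma vc_emit:
  assumes p: "p \<notin> scratch" "p \<notin> reads a \<union> reads b \<union> reads c \<union> reads d"
    and r: "(reads a \<union> reads b \<union> reads c \<union> reads d) \<inter> {''k'', ''j'', ''x'', ''m'', ''l''} = {}"
  shows "vc W (emit p a b c d) Q s \<longleftrightarrow>
    1 < W \<and> s ''l'' 0 + 1 < W \<and> s ''h'' 0 < W \<and>
    afits W a s \<and> afits W b s \<and> afits W c s \<and> afits W d s \<and>
    Q (emitted p (aval a s, aval b s, aval c s, aval d s) s)"
proof -
  have 1: "aval e (s(''k'' := f)) = aval e s" "afits W e (s(''k'' := f)) = afits W e s"
     "aval e (s(''j'' := f)) = aval e s" "afits W e (s(''j'' := f)) = afits W e s"
     "aval e (s(''x'' := f)) = aval e s" "afits W e (s(''x'' := f)) = afits W e s"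
    if "e \<in> {a, b, c, d}" for e f s
    using that r by (auto intro!: aval_reads afits_reads)
  show ?thesis using p(1) unfolding emit_def
    by (simp add: 1 scratch_def emitted_def cong: conj_cong) (auto simp: fun_upd_def)
qed

lemma emitted_simps [simp]:
  "p \<notin> scratch \<Longrightarrow> labs (emitted p l s) = (labs s)(s ''l'' 0 := l)"
  "p \<notin> scratch \<Longrightarrow> emitted p l s ''l'' 0 = Suc (s ''l'' 0)"
  "p \<notin> scratch \<Longrightarrow> emitted p l s p = (s p)(s ''l'' 0 := s ''h'' 0)"
  "y \<notin> {''k'', ''j'', ''x'', ''m'', ''l'', p} \<Longrightarrow> emitted p l s y = s y"
  by (auto simp: emitted_def labs_def scratch_def fun_eq_iff split: prod.splits)

definition succs :: "bool \<Rightarrow> (nat \<Rightarrow> nat) \<Rightarrow> nat \<Rightarrow> nat \<Rightarrow> nat \<Rightarrow> nat \<Rightarrow> label \<Rightarrow> label list" where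
  "succs h g y n d z = (\<lambda>(k, j, x, m).
     if k = 0 then []
     else if k = 1 then
       if j = 0 then (0, 0, 0, 0) # (if entry g x m = h then [] else [(0, 0, 0, 0)])
       else (2, j - 1, x, 2 * m) # (if h then [(2, j - 1, x, 2 * m + 1)] else [])
     else if k = 2 then [(3, j, x, 2 * m), (4, j, x, 2 * m + 1)]
     else if k = 3 then [(1, j, x, m)]
     else if k = 4 then [(1, j, x, m), (0, 0, 0, 0)]
     else if k = 5 then if j = 0 then [(1, y, x, 0)] else [(5, j - 1, x, 0)]
     else if k = 6 then
       if j = 0 then [(5, if h then 0 else n + 1, clip z x, 0)]
       else [(6, j - 1, 2 * x, 0), (6, j - 1, 2 * x + d, 0)]
     else if k = 7 then if j = 0 then [(5, n + 1, z, 0)] else [(7, j - 1, 0, 0), (7, j - 1, 0, 0)]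
     else if j = 0 then [(6, n, 0, 0)] else [(8, j - 1, 0, 0), (7, j - 1, 0, 0)])"

text \<open>A label of kind 5 with \<open>j = 0\<close> is still a path node, with the gadget as its
  child; hence \<open>Suc j\<close>.\<close>

definition tree_of :: "bool \<Rightarrow> (nat \<Rightarrow> nat) \<Rightarrow> nat \<Rightarrow> nat \<Rightarrow> nat \<Rightarrow> nat \<Rightarrow> label \<Rightarrow> btree" where
  "tree_of h g y n d z = (\<lambda>(k, j, x, m).
     let sel = \<lambda>x. path (if h then 2 else n + 3) (gad h (entry g (clip z x)) y 0);
         uni = path (n + 3) (gad h (entry g z) y 0) in
     if k = 0 then lf
     else if k = 1 then gad h (entry g x) j m
     else if k = 2 then and_node (gad h (entry g x) j (2 * m)) (gad h (entry g x) j (2 * m + 1))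
     else if k = 3 then Node (gad h (entry g x) j m) Empty
     else if k = 4 then Node (gad h (entry g x) j m) lf
     else if k = 5 then path (Suc j) (gad h (entry g x) y 0)
     else if k = 6 then ctree d j sel x
     else if k = 7 then utree j uni
     else spine j uni (path 1 (ctree d n sel 0)))"

lemma tree_of_roots:
  "tree_of False g y n d z (6, n, 0, 0) = G_tree n y d z g"
  "tree_of True g y n d z (8, n, 0, 0) = H_tree n y d z g"
  by (simp_all add: tree_of_def G_tree_def H_tree_def)

fun node_of :: "btree list \<Rightarrow> btree" where
  "node_of [] = Node Empty Empty"
| "node_of [a] = Node a Empty"
| "node_of (a # b # _) = Node a b"

text \<open>The unfolding equation of the labels. Together with \<open>tree_of_nonempty\<close> and
  \<open>length_succs\<close> it is all that the queue has to know about the shape of the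
  trees.\<close>

lemma tree_of_succs:
  "tree_of h g y n d z l = node_of (map (tree_of h g y n d z) (succs h g y n d z l))"
proof -
  obtain k j x m where l: "l = (k, j, x, m)" by (cases l) auto
  have p: "path 2 t = Node (Node t Empty) Empty" "path (n + 3) t = Node (Node (path (Suc n) t) Empty) Empty"
    for t by (simp_all add: numeral_2_eq_2 numeral_3_eq_3)
  consider "k = 0" | "k = 1" | "k = 2" | "k = 3" | "k = 4" | "k = 5" | "k = 6" | "k = 7" | "k \<ge> 8"
    by linarith
  then show ?thesis unfolding l
  proof cases
  qed (cases j; simp add: succs_def tree_of_def lf_def and_node_def numeral_3_eq_3 p)+
qed

lemma tree_of_nonempty: "tree_of h g y n d z l \<noteq> Empty"
  unfolding tree_of_succs[of h g y n d z l]
  by (cases "map (tree_of h g y n d z) (succs h g y n d z l)" rule: node_of.cases) auto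

text \<open>Keeps all components of the labels in use below the number of words.\<close>

definition valid :: "nat \<Rightarrow> nat \<Rightarrow> nat \<Rightarrow> nat \<Rightarrow> label \<Rightarrow> bool" where
  "valid y n d z = (\<lambda>(k, j, x, m).
     k \<le> 8 \<and> j \<le> n + y + 1 \<and>
     (if k = 6 then (x + d) * 2 ^ j \<le> 2 ^ n * d else x \<le> z) \<and>
     (if k \<in> {1, 3, 4} then (m + 1) * 4 ^ j \<le> d else if k = 2 then 2 * (m + 1) * 4 ^ j \<le> d else m = 0))"

text \<open>In a \<open>ctree\<close> the bound follows the rightmost leaf:
  \<open>(2 * x + d + d) * 2 ^ (j - 1) = (x + d) * 2 ^ j\<close> for positive \<open>j\<close>. The
  premise \<open>4 ^ y \<le> d\<close> is for the step into a gadget.\<close>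

lemma valid_succs:
  assumes "valid y n d z l" "4 ^ y \<le> d" "l' \<in> set (succs h g y n d z l)"
  shows "valid y n d z l'"
proof -
  obtain k j x m where l: "l = (k, j, x, m)" by (cases l) auto
  consider "k = 0" | "k = 1" | "k = 2" | "k = 3" | "k = 4" | "k = 5" | "k = 6" | "k = 7" | "k = 8"
    using assms(1) unfolding valid_def l by fastforce
  then show ?thesis using assms unfolding l
  proof cases
  qed (cases j; auto simp: succs_def valid_def clip_def algebra_simps split: if_splits)+
qed

lemma valid_bounds:
  assumes "valid y n d z (k, j, x, m)" "0 < d"
  shows "k \<le> 8" "j \<le> n + y + 1" "x \<le> max (2 ^ n * d) z" "m < d"
proof -
  show "k \<le> 8" "j \<le> n + y + 1" using assms by (auto simp: valid_def)
  have p: "a \<le> a * 2 ^ j" "a \<le> a * 4 ^ j" for a :: nat by simp_all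
  show "x \<le> max (2 ^ n * d) z"
    using assms order.trans[OF p(1)[of "x + d"], of "2 ^ n * d"]
    by (auto simp: valid_def split: if_splits)
  show "m < d" 
    using assms order.trans[OF p(2)[of "m + 1"], of d] order.trans[OF p(2)[of "2 * (m + 1)"], of d]
    by (auto simp: valid_def split: if_splits)
qed

section \<open>Unfolding a tree with a queue\<close>

primrec extend :: "(nat \<Rightarrow> 'a) \<Rightarrow> nat \<Rightarrow> 'a list \<Rightarrow> nat \<Rightarrow> 'a" where
  "extend f a [] = f"
| "extend f a (x # xs) = extend (f(a := x)) (Suc a) xs"

text \<open>The queue stores labels while its invariant speaks of their trees; this passes from one
  to the other.\<close>

lemma extend_comp: "(\<lambda>v. F (extend f a xs v)) = extend (\<lambda>v. F (f v)) a (map F xs)"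
  by (induction xs arbitrary: f a) (simp_all add: fun_upd_def if_distrib)

lemma extend_old: "v < a \<Longrightarrow> extend f a xs v = f v"
  by (induction xs arbitrary: f a) auto

lemma extend_new: "a \<le> v \<Longrightarrow> v < a + length xs \<Longrightarrow> extend f a xs v = xs ! (v - a)"
proof (induction xs arbitrary: f a)
  case (Cons x xs)
  then show ?case by (cases "v = a") (auto simp: extend_old Suc_diff_le[symmetric] nth_Cons')
qed simp

text \<open>The sum counts the nodes still to be generated, so that the loop makes exactly \<open>nodes t\<close> rounds.\<close>

definition bfs_inv :: "btree \<Rightarrow> nat \<Rightarrow> nat \<Rightarrow> (nat \<Rightarrow> nat) \<Rightarrow> (nat \<Rightarrow> btree) \<Rightarrow> bool" where
  "bfs_inv t i l par \<tau> \<longleftrightarrow> i \<le> l \<and> 0 < l \<and> \<tau> 0 = t \<and>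
     (\<forall>v. 0 < v \<and> v < l \<longrightarrow> par v < v \<and> par v < i) \<and>
     (\<forall>v<i. shaped_at l par \<tau> v) \<and>
     (\<forall>v<l. \<tau> v \<noteq> Empty) \<and>
     i + (\<Sum>v = i..<l. nodes (\<tau> v)) = nodes t"

lemma bfs_inv_init: "t \<noteq> Empty \<Longrightarrow> \<tau> 0 = t \<Longrightarrow> bfs_inv t 0 1 par \<tau>"
  by (auto simp: bfs_inv_def)

lemma nodes_pos: "t \<noteq> Empty \<Longrightarrow> 0 < nodes t"
  by (cases t) auto

text \<open>Each waiting tree counts at least one node, so the queue never outgrows the final tree.
  This keeps its end below the number of words.\<close>

lemma bfs_inv_queue: assumes "bfs_inv t i l par \<tau>" shows "l \<le> nodes t"
proof -
  have "(\<Sum>v = i..<l. 1) \<le> (\<Sum>v = i..<l. nodes (\<tau> v))"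
    using assms nodes_pos by (intro sum_mono) (auto simp: bfs_inv_def Suc_le_eq)
  then show ?thesis using assms by (auto simp: bfs_inv_def)
qed

lemma bfs_inv_nonfinal: "bfs_inv t i l par \<tau> \<Longrightarrow> i < nodes t \<Longrightarrow> i < l"
  by (cases "i = l") (auto simp: bfs_inv_def)

lemma bfs_inv_final:
  assumes "bfs_inv t (nodes t) l par \<tau>" shows "l = nodes t" "shaped_tree (nodes t) par \<tau>"
proof -
  show "l = nodes t" using bfs_inv_queue[OF assms] assms by (auto simp: bfs_inv_def)
  then show "shaped_tree (nodes t) par \<tau>"
    using assms by unfold_locales (auto simp: bfs_inv_def)
qed

lemma shaped_at_cong:
  assumes "shaped_at l par \<tau> v" "kids l' par' v = kids l par v" "v < l"
    "\<And>w. w < l \<Longrightarrow> \<tau>' w = \<tau> w"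
  shows "shaped_at l' par' \<tau>' v"
proof -
  have "\<tau>' w = \<tau> w" if "w \<in> kids l par v" for w
    using that assms(4) by (auto simp: kids_iff)
  moreover have "\<tau>' v = \<tau> v" using assms(3,4) by simp
  ultimately show ?thesis using assms(1) unfolding shaped_at_def assms(2) by (smt (verit) insertCI)
qed

text \<open>The tree at the head consists of its root and the trees appended, so one more processed
  node leaves the total count unchanged.\<close>

lemma bfs_inv_step:
  assumes inv: "bfs_inv t i l par \<tau>" and il: "i < l" and ts: "\<tau> i = node_of ts"
    "length ts \<le> 2" "Empty \<notin> set ts"
  shows "bfs_inv t (Suc i) (l + length ts) (extend par l (map (\<lambda>_. i) ts)) (extend \<tau> l ts)"
proof -
  define par' where "par' = extend par l (map (\<lambda>_. i) ts)"
  define \<tau>' where "\<tau>' = extend \<tau> l ts"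
  define l' where "l' = l + length ts"
  consider "ts = []" | a where "ts = [a]" | a b where "ts = [a, b]"
    using ts(2) by (cases ts rule: node_of.cases) auto
  note tsc = this
  have old: "par' v = par v \<and> \<tau>' v = \<tau> v" if "v < l" for v
    using that by (simp add: par'_def \<tau>'_def extend_old)
  have new: "par' v = i \<and> \<tau>' v = ts ! (v - l)" if "l \<le> v" "v < l'" for v
    using that by (simp add: par'_def \<tau>'_def l'_def extend_new)
  have inv': "\<tau> 0 = t" "\<And>v. 0 < v \<Longrightarrow> v < l \<Longrightarrow> par v < v \<and> par v < i"
    "\<And>v. v < i \<Longrightarrow> shaped_at l par \<tau> v" "\<And>v. v < l \<Longrightarrow> \<tau> v \<noteq> Empty"
    "i + (\<Sum>v = i..<l. nodes (\<tau> v)) = nodes t" using inv by (auto simp: bfs_inv_def)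
  have kids_old: "kids l' par' v = kids l par v" if "v < i" for v
  proof -
    have "w < l' \<and> par' w = v \<longleftrightarrow> w < l \<and> par w = v" for w
      using old[of w] new[of w] that by (cases "w < l") (auto simp: l'_def)
    then show ?thesis by (auto simp: kids_def)
  qed
  \<comment> \<open>No older node has parent \<open>i\<close>, since parents of queued nodes have
    been processed before.\<close>
  have kids_new: "kids l' par' i = {l..<l'}"
  proof -
    have "w \<in> kids l' par' i \<longleftrightarrow> w \<in> {l..<l'}" for w
    proof (cases "w < l")
      case True
      then show ?thesis using old[of w] inv'(2)[of w] by (auto simp: kids_iff)
    next
      case False
      then show ?thesis using new[of w] il by (simp add: kids_iff) linarith
    qed
    then show ?thesis by blast
  qed
  have shi: "shaped_at l' par' \<tau>' i"
    using tsc
  proof cases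
    case 1
    then have "{l..<l'} = {}" "\<tau>' i = Node Empty Empty" using old[OF il] ts(1) by (auto simp: l'_def)
    then show ?thesis unfolding shaped_at_def kids_new by simp
  next
    case (2 a)
    then have "{l..<l'} = {l}" "\<tau>' i = Node (\<tau>' l) Empty"
      using old[OF il] ts(1) new[of l] by (auto simp: l'_def)
    then show ?thesis unfolding shaped_at_def kids_new by blast
  next
    case (3 a b)
    then have "{l..<l'} = {l, Suc l}" "\<tau>' i = Node (\<tau>' l) (\<tau>' (Suc l))"
      using old[OF il] ts(1) new[of l] new[of "Suc l"] by (auto simp: l'_def)
    moreover have "l \<noteq> Suc l" by simp
    ultimately show ?thesis unfolding shaped_at_def kids_new by blast
  qed
  have nts: "nodes (\<tau> i) = Suc (\<Sum>v = l..<l'. nodes (\<tau>' v))"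
    using tsc
  proof cases
    case 1 then show ?thesis using ts(1) by (simp add: l'_def)
  next
    case (2 a) then show ?thesis using ts(1) new[of l] by (simp add: l'_def)
  next
    case (3 a b)
    then have "{l..<l'} = {l, Suc l}" "\<tau>' l = a" "\<tau>' (Suc l) = b"
      using new[of l] new[of "Suc l"] by (auto simp: l'_def)
    then show ?thesis using 3 ts(1) by simp
  qed
  have "(\<Sum>v = Suc i..<l'. nodes (\<tau>' v)) = (\<Sum>v = Suc i..<l. nodes (\<tau>' v)) + (\<Sum>v = l..<l'. nodes (\<tau>' v))"
    using il by (intro sum.atLeastLessThan_concat[symmetric]) (auto simp: l'_def)
  also have "(\<Sum>v = Suc i..<l. nodes (\<tau>' v)) = (\<Sum>v = Suc i..<l. nodes (\<tau> v))"
    using old by (intro sum.cong) auto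
  finally have "Suc i + (\<Sum>v = Suc i..<l'. nodes (\<tau>' v)) = nodes t"
    using inv'(5) nts sum.atLeast_Suc_lessThan[OF il, of "\<lambda>v. nodes (\<tau> v)"] by linarith
  moreover have "\<tau>' 0 = t" using old[of 0] il inv'(1) by simp
  moreover have "par' v < v \<and> par' v < Suc i" if "0 < v" "v < l'" for v
    using old[of v] new[of v] inv'(2)[of v] that il by (cases "v < l") auto
  moreover have "shaped_at l' par' \<tau>' v" if "v < Suc i" for v
  proof (cases "v = i")
    case False
    then have v: "v < i" using that by simp
    show ?thesis
      by (rule shaped_at_cong[OF inv'(3)[OF v] kids_old[OF v]]) (use old il v in auto)
  qed (use shi in simp)
  moreover have "\<tau>' v \<noteq> Empty" if "v < l'" for v
  proof (cases "v < l")
    case False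
    then have "\<tau>' v \<in> set ts" using new[of v] that by (auto simp: l'_def)
    then show ?thesis using ts(3) by auto
  qed (use old inv'(4) in auto)
  moreover have "Suc i \<le> l'" "0 < l'" using il by (auto simp: l'_def)
  ultimately have "bfs_inv t (Suc i) l' par' \<tau>'" unfolding bfs_inv_def by blast
  then show ?thesis unfolding par'_def \<tau>'_def l'_def .
qed

section \<open>The program that processes one node of the queue\<close>

fun cascade :: "nat \<Rightarrow> com list \<Rightarrow> com" where
  "cascade i [] = Skip"
| "cascade i (c # cs) = Cond (Less (V ''u'') (Num (Suc i))) c (cascade (Suc i) cs)"

text \<open>The kinds are tested in increasing order by \<open>u < i + 1\<close>, which amounts to
  equality once all smaller kinds are excluded.\<close>

lemma vc_cascade:
  assumes "i \<le> s ''u'' 0" "s ''u'' 0 < i + length cs" "i + length cs < W"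
    and "vc W (cs ! (s ''u'' 0 - i)) Q s"
  shows "vc W (cascade i cs) Q s"
  using assms
proof (induction cs arbitrary: i)
  case (Cons c cs)
  show ?case
  proof (cases "s ''u'' 0 = i")
    case False
    then have "vc W (cascade (Suc i) cs) Q s" using Cons.prems by (intro Cons.IH) (auto simp: nth_Cons')
    then show ?thesis using Cons.prems False by simp
  qed (use Cons.prems in simp)
qed simp

text \<open>The position in the list is the kind, as in \<open>succs\<close>. The flag
  \<open>h\<close> parametrises the program text and is not tested at run time.\<close>

definition branches :: "bool \<Rightarrow> string \<Rightarrow> string \<Rightarrow> com list" where
  "branches h p src =
    (let q = V ''q''; r = V ''r''; s = V ''s''; nul = Num 0; one = Num 1;
         leaf = emit p nul nul nul nul; pred = Sub q one; twice = Add s s; twice1 = Add (Add s s) one;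
         empty = Less q one
     in
     [Skip,
      Cond empty
        (Seq leaf (if h then Cond (Less nul (Get src (Add r s))) Skip leaf
                   else Cond (Less nul (Get src (Add r s))) leaf Skip))
        (Seq (emit p (Num 2) pred r twice) (if h then emit p (Num 2) pred r twice1 else Skip)),
      Seq (emit p (Num 3) q r twice) (emit p (Num 4) q r twice1),
      emit p one q r s,
      Seq (emit p one q r s) leaf,
      Cond empty (emit p one (V ''y'') r nul) (emit p (Num 5) pred r nul),
      Cond empty
        (Cond (Less r (V ''z''))
           (emit p (Num 5) (if h then nul else Add (V ''n'') one) r nul)
           (emit p (Num 5) (if h then nul else Add (V ''n'') one) nul nul))
        (Seq (emit p (Num 6) pred (Add r r) nul) (emit p (Num 6) pred (Add (Add r r) (V ''D'')) nul)),
      Cond empty (emit p (Num 5) (Add (V ''n'') one) (V ''z'') nul)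
        (Seq (emit p (Num 7) pred nul nul) (emit p (Num 7) pred nul nul)),
      Cond empty (emit p (Num 6) (V ''n'') nul nul)
        (Seq (emit p (Num 8) pred nul nul) (emit p (Num 7) pred nul nul))])"

definition names_ok :: "string \<Rightarrow> string \<Rightarrow> bool" where
  "names_ok p src \<longleftrightarrow> p \<in> {''G_parent'', ''H_parent''} \<and> src \<in> {''A'', ''B''}"

definition params :: "string \<Rightarrow> (nat \<Rightarrow> nat) \<Rightarrow> nat \<Rightarrow> nat \<Rightarrow> nat \<Rightarrow> nat \<Rightarrow> state \<Rightarrow> bool" where
  "params src g y n d z s \<longleftrightarrow>
     s src = g \<and> s ''y'' 0 = y \<and> s ''n'' 0 = n \<and> s ''D'' 0 = d \<and> s ''z'' 0 = z"

lemma dispatch_correct: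
  assumes ok: "names_ok p src" and par: "params src g y n d z s" and g: "\<And>v. g v \<le> 1"
    and lab: "s ''u'' 0 = k" "s ''q'' 0 = j" "s ''r'' 0 = x" "s ''s'' 0 = m"
    and hd: "s ''h'' 0 = i" "s ''l'' 0 = l"
    and W: "i < W" "l + 2 < W" "n + y + 2 < W" "2 * x + d < W" "x + m < W" "2 * m + 1 < W" "z < W" "9 < W" "k \<le> 8" "j < W"
  shows "vc W (cascade 0 (branches h p src)) (\<lambda>s'. s' ''h'' 0 = i \<and>
      s' ''l'' 0 = l + length (succs h g y n d z (k, j, x, m)) \<and>
      labs s' = extend (labs s) l (succs h g y n d z (k, j, x, m)) \<and>
      s' p = extend (s p) l (map (\<lambda>_. i) (succs h g y n d z (k, j, x, m)))) s"
proof -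
  have p: "p \<notin> scratch" "p \<noteq> ''y''" "p \<noteq> ''n''" "p \<noteq> ''D''" "p \<noteq> ''z''" "p \<noteq> src"
    and src: "src \<notin> {''k'', ''j'', ''x'', ''m'', ''l''}"
    using ok by (auto simp: names_ok_def scratch_def)
  have p': "p \<noteq> ''h''" "p \<noteq> ''l''" "p \<noteq> ''u''" "p \<noteq> ''q''" "p \<noteq> ''r''" "p \<noteq> ''s''"
    using p(1) by (auto simp: scratch_def)
  have par': "s src = g" "s ''y'' 0 = y" "s ''n'' 0 = n" "s ''D'' 0 = d" "s ''z'' 0 = z"
    using par by (auto simp: params_def)
  have W': "2 < W" "3 < W" "4 < W" "5 < W" "6 < W" "7 < W" "8 < W" "2 * x < W" "d < W" "x < W" "m < W" "0 < W" "y < W" "n < W" using W by auto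
  have g1: "g v < W" for v using g[of v] W by simp
  have src': "emitted p w s src = g" for w
    using src p(6) par' by (subst emitted_simps(4)) auto
  note S = vc_emit[OF p(1)] p p' p'[symmetric] p(2-)[symmetric] src src' par' lab hd W W' g1 branches_def[unfolded Let_def] succs_def
    entry_def clip_def mult_2[symmetric]
  consider "k = 0" | "k = 1" | "k = 2" | "k = 3" | "k = 4" | "k = 5" | "k = 6" | "k = 7" | "k = 8"
    using W by linarith
  then have "vc W (branches h p src ! k) (\<lambda>s'. s' ''h'' 0 = i \<and>
      s' ''l'' 0 = l + length (succs h g y n d z (k, j, x, m)) \<and>
      labs s' = extend (labs s) l (succs h g y n d z (k, j, x, m)) \<and>
      s' p = extend (s p) l (map (\<lambda>_. i) (succs h g y n d z (k, j, x, m)))) s"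
  proof cases
    case 1 then show ?thesis using W by (simp add: S)
  next
    case 2 then show ?thesis using W by (cases h; cases j) (simp_all add: S)
  next
    case 3 then show ?thesis using W by (simp add: S)
  next
    case 4 then show ?thesis using W by (simp add: S)
  next
    case 5 then show ?thesis using W by (simp add: S)
  next
    case 6 then show ?thesis using W by (cases j) (simp_all add: S)
  next
    case 7 then show ?thesis using W by (cases h; cases j) (simp_all add: S)
  next
    case 8 then show ?thesis using W by (cases j) (simp_all add: S)
  next
    case 9 then show ?thesis using W by (cases j) (simp_all add: S)
  qed
  then show ?thesis using W lab by (intro vc_cascade) (simp_all add: branches_def Let_def)
qed

lemma vc_mono: "vc W c Q s \<Longrightarrow> (\<And>s'. Q s' \<Longrightarrow> R s') \<Longrightarrow> vc W c R s"
  by (induction c arbitrary: Q R s) auto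

text \<open>The label at the head is first copied to scalars, because \<open>vc_emit\<close> forbids
  expressions that read the label arrays.\<close>

definition body :: "bool \<Rightarrow> string \<Rightarrow> string \<Rightarrow> com" where
  "body h p src =
     Seq (assign ''u'' (Get ''k'' (V ''h''))) (Seq (assign ''q'' (Get ''j'' (V ''h'')))
     (Seq (assign ''r'' (Get ''x'' (V ''h''))) (Seq (assign ''s'' (Get ''m'' (V ''h'')))
     (Seq (cascade 0 (branches h p src)) (assign ''h'' (Add (V ''h'') (Num 1)))))))"

lemma writes_emit: "writes (emit p a b c d) = {''k'', ''j'', ''x'', ''m'', p, ''l''}"
  by (auto simp: emit_def)

lemma writes_body: "writes (body h p src) \<subseteq> insert p scratch"
  by (cases h) (auto simp: body_def branches_def Let_def writes_emit scratch_def)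

lemma max_cost_body: "max_cost (body h p src) \<le> 300"
  by (cases h) (simp_all add: body_def branches_def Let_def emit_def)

text \<open>Leaves room for the largest intermediate values, \<open>2 * x + d\<close>,
  \<open>x + m\<close> and \<open>2 * m + 1\<close>, where \<open>x \<le> max (2 ^ n * d) z\<close>
  and \<open>m < d\<close>.\<close>

definition bounded :: "nat \<Rightarrow> nat \<Rightarrow> nat \<Rightarrow> nat \<Rightarrow> nat \<Rightarrow> bool" where
  "bounded W y n d z \<longleftrightarrow> n + y + 2 < W \<and> 2 * (2 ^ n * d) + 2 * d < W \<and> 2 * z + 2 * d < W \<and> 9 < W \<and> 0 < d"

lemma body_correct:
  assumes ok: "names_ok p src" and par: "params src g y n d z s" and g: "\<And>v. g v \<le> 1"
    and hd: "s ''h'' 0 = i" "s ''l'' 0 = l" "i < l" "l + 2 < W"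
    and val: "valid y n d z (labs s i)" and W: "bounded W y n d z"
  shows "vc W (body h p src) (\<lambda>s'. s' ''h'' 0 = Suc i \<and>
      s' ''l'' 0 = l + length (succs h g y n d z (labs s i)) \<and>
      labs s' = extend (labs s) l (succs h g y n d z (labs s i)) \<and>
      s' p = extend (s p) l (map (\<lambda>_. i) (succs h g y n d z (labs s i)))) s"
proof -
  obtain k j x m where lab: "labs s i = (k, j, x, m)" by (cases "labs s i") auto
  then have l': "s ''k'' i = k" "s ''j'' i = j" "s ''x'' i = x" "s ''m'' i = m"
    by (auto simp: labs_def)
  have b: "k \<le> 8" "j \<le> n + y + 1" "x \<le> max (2 ^ n * d) z" "m < d"
    using valid_bounds[of y n d z k j x m] val W by (auto simp: lab bounded_def)
  have W': "k < W" "j < W" "x < W" "m < W" "i < W" "0 < W" "1 < W" "Suc i < W"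
    "2 * x + d < W" "x + m < W" "2 * m + 1 < W" "z < W" "n + y + 2 < W" "9 < W"
    using b W hd by (auto simp: bounded_def)
  have p: "p \<notin> scratch" "src \<notin> scratch" using ok by (auto simp: names_ok_def scratch_def)
  define s1 where "s1 = s(''u'' := (s ''u'')(0 := k), ''q'' := (s ''q'')(0 := j),
    ''r'' := (s ''r'')(0 := x), ''s'' := (s ''s'')(0 := m))"
  have s1: "params src g y n d z s1" "s1 ''u'' 0 = k" "s1 ''q'' 0 = j" "s1 ''r'' 0 = x" "s1 ''s'' 0 = m"
    "s1 ''h'' 0 = i" "s1 ''l'' 0 = l" "labs s1 = labs s" "s1 p = s p"
    using par p hd by (auto simp: s1_def params_def labs_def fun_eq_iff scratch_def)
  have "vc W (cascade 0 (branches h p src)) (\<lambda>s'. s' ''h'' 0 = i \<and>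
      s' ''l'' 0 = l + length (succs h g y n d z (k, j, x, m)) \<and>
      labs s' = extend (labs s1) l (succs h g y n d z (k, j, x, m)) \<and>
      s' p = extend (s1 p) l (map (\<lambda>_. i) (succs h g y n d z (k, j, x, m)))) s1"
    by (rule dispatch_correct[OF ok s1(1) g s1(2-7)]) (use W' b hd in auto)
  then have "vc W (cascade 0 (branches h p src)) (vc W (assign ''h'' (Add (V ''h'') (Num 1)))
     (\<lambda>s'. s' ''h'' 0 = Suc i \<and>
      s' ''l'' 0 = l + length (succs h g y n d z (k, j, x, m)) \<and>
      labs s' = extend (labs s) l (succs h g y n d z (k, j, x, m)) \<and>
      s' p = extend (s p) l (map (\<lambda>_. i) (succs h g y n d z (k, j, x, m))))) s1"
    by (rule vc_mono) (use p W' s1 in \<open>auto simp: labs_def fun_eq_iff scratch_def\<close>)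
  then show ?thesis unfolding body_def lab
    using W' hd l' by (simp add: s1_def)
qed

lemma length_succs: "length (succs h g y n d z l) \<le> 2"
  by (cases l) (auto simp: succs_def)

definition bfs :: "bool \<Rightarrow> string \<Rightarrow> string \<Rightarrow> com" where
  "bfs h p src = While (Less (V ''h'') (V ''l'')) (body h p src)"

text \<open>Each node costs at most 300 steps for the body and 6 for the loop test; the last,
  failing test accounts for the final 6.\<close>

lemma runs_bfs:
  fixes h g y n d z \<rho>
  defines "T \<equiv> tree_of h g y n d z"
  assumes ok: "names_ok p src" and par: "params src g y n d z s" and g: "\<And>v. g v \<le> 1"
    and d: "4 ^ y \<le> d" and W: "bounded W y n d z" "nodes (T \<rho>) + 2 < W"
    and s: "s ''h'' 0 = 0" "s ''l'' 0 = 1" "labs s 0 = \<rho>" "valid y n d z \<rho>"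
  shows "runs W (bfs h p src) s (nodes (T \<rho>) * 306 + 6)
    (\<lambda>s'. s' ''l'' 0 = nodes (T \<rho>) \<and> (\<exists>\<tau>. shaped_tree (nodes (T \<rho>)) (s' p) \<tau> \<and> \<tau> 0 = T \<rho>))"
proof -
  define I where "I i s' \<longleftrightarrow> s' ''h'' 0 = i \<and>
     bfs_inv (T \<rho>) i (s' ''l'' 0) (s' p) (\<lambda>v. T (labs s' v)) \<and>
     (\<forall>v<s' ''l'' 0. valid y n d z (labs s' v)) \<and> params src g y n d z s'" for i s'
  have ne: "T l \<noteq> Empty" for l by (simp add: T_def tree_of_nonempty)
  have frame: "params src g y n d z s'" if "params src g y n d z s1"
    "\<forall>x. x \<notin> writes (body h p src) \<longrightarrow> s' x = s1 x" for s1 s'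
  proof -
    have "x \<notin> writes (body h p src)" if "x \<in> {src, ''y'', ''n'', ''D'', ''z''}" for x
      using that ok writes_body[of h p src] by (auto simp: names_ok_def scratch_def)
    then show ?thesis using that by (simp add: params_def)
  qed
  have step: "bfits W (Less (V ''h'') (V ''l'')) s1 \<and> bval (Less (V ''h'') (V ''l'')) s1 \<and>
      runs W (body h p src) s1 300 (I (Suc i))" if i: "i < nodes (T \<rho>)" and I: "I i s1" for i s1
  proof -
    define l where "l = s1 ''l'' 0"
    define ls where "ls = succs h g y n d z (labs s1 i)"
    have inv: "bfs_inv (T \<rho>) i l (s1 p) (\<lambda>v. T (labs s1 v))" and hd: "s1 ''h'' 0 = i"
      and val: "\<And>v. v < l \<Longrightarrow> valid y n d z (labs s1 v)" and par1: "params src g y n d z s1"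
      using I by (auto simp: I_def l_def)
    have il: "i < l" using bfs_inv_nonfinal[OF inv i] .
    have lW: "l + 2 < W" using bfs_inv_queue[OF inv] W by simp
    have "runs W (body h p src) s1 300 (\<lambda>s'. (s' ''h'' 0 = Suc i \<and> s' ''l'' 0 = l + length ls \<and>
        labs s' = extend (labs s1) l ls \<and> s' p = extend (s1 p) l (map (\<lambda>_. i) ls)) \<and>
        (\<forall>x. x \<notin> writes (body h p src) \<longrightarrow> s' x = s1 x))"
      unfolding ls_def
      by (rule runs_mono[OF runs_frame[OF vc_runs[OF body_correct[OF ok par1 g hd l_def[symmetric] il lW val[OF il] W(1)]]]])
        (use max_cost_body in auto)
    then have "runs W (body h p src) s1 300 (I (Suc i))"
    proof (rule runs_mono)
      fix s' assume *: "(s' ''h'' 0 = Suc i \<and> s' ''l'' 0 = l + length ls \<and>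
        labs s' = extend (labs s1) l ls \<and> s' p = extend (s1 p) l (map (\<lambda>_. i) ls)) \<and>
        (\<forall>x. x \<notin> writes (body h p src) \<longrightarrow> s' x = s1 x)"
      have "bfs_inv (T \<rho>) (Suc i) (l + length (map T ls)) (extend (s1 p) l (map (\<lambda>_. i) (map T ls)))
        (extend (\<lambda>v. T (labs s1 v)) l (map T ls))"
      proof (rule bfs_inv_step[OF inv il])
        show "T (labs s1 i) = node_of (map T ls)"
          unfolding ls_def T_def by (rule tree_of_succs)
        show "length (map T ls) \<le> 2" by (simp add: ls_def length_succs)
        show "Empty \<notin> set (map T ls)" using ne[symmetric] by (simp add: image_iff)
      qed
      then have "bfs_inv (T \<rho>) (Suc i) (s' ''l'' 0) (s' p) (\<lambda>v. T (labs s' v))"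
        using * by (simp add: extend_comp comp_def)
      moreover have "valid y n d z (labs s' v)" if "v < s' ''l'' 0" for v
      proof (cases "v < l")
        case True then show ?thesis using * val by (simp add: extend_old)
      next
        case False
        then have "labs s' v \<in> set ls" using * that by (simp add: extend_new)
        then show ?thesis using valid_succs[OF val[OF il] d] by (simp add: ls_def)
      qed
      ultimately show "I (Suc i) s'" using * frame[OF par1] by (simp add: I_def)
    qed simp
    then show ?thesis using hd il lW by (simp add: l_def)
  qed
  have "runs W (bfs h p src) s
     (nodes (T \<rho>) * (1 + bcost (Less (V ''h'') (V ''l'')) + 300) + (1 + bcost (Less (V ''h'') (V ''l''))))
     (I (nodes (T \<rho>)))"
    unfolding bfs_def
  proof (rule runs_While[where I = I and n = "nodes (T \<rho>)" and C = 300], rule step)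
    show "bfits W (Less (V ''h'') (V ''l'')) s1 \<and> \<not> bval (Less (V ''h'') (V ''l'')) s1"
      if "I (nodes (T \<rho>)) s1" for s1
    proof -
      have "s1 ''l'' 0 = nodes (T \<rho>)"
        using that bfs_inv_final(1)[of "T \<rho>" "s1 ''l'' 0"] by (auto simp: I_def)
      then show ?thesis using that W by (simp add: I_def)
    qed
    show "I 0 s" using s par bfs_inv_init[OF ne] by (simp add: I_def)
  qed
  then show ?thesis
  proof (rule runs_mono)
    fix s' assume "I (nodes (T \<rho>)) s'"
    then have inv: "bfs_inv (T \<rho>) (nodes (T \<rho>)) (s' ''l'' 0) (s' p) (\<lambda>v. T (labs s' v))"
      by (simp add: I_def)
    show "s' ''l'' 0 = nodes (T \<rho>) \<and> (\<exists>\<tau>. shaped_tree (nodes (T \<rho>)) (s' p) \<tau> \<and> \<tau> 0 = T \<rho>)"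
      using bfs_inv_final[OF inv] inv unfolding bfs_inv_def by blast
  qed simp
qed

definition build :: "bool \<Rightarrow> string \<Rightarrow> string \<Rightarrow> string \<Rightarrow> com" where
  "build h p sz src =
     Seq (Seq (assign ''h'' (Num 0)) (Seq (assign ''l'' (Num 1))
     (Seq (assign ''k'' (Num (if h then 8 else 6))) (Seq (assign ''j'' (V ''n''))
     (Seq (assign ''x'' (Num 0)) (assign ''m'' (Num 0)))))))
     (Seq (bfs h p src) (assign sz (V ''l'')))"

lemma writes_build: "writes (build h p sz src) \<subseteq> {p, sz} \<union> scratch"
proof -
  have "writes (body h p src) \<subseteq> {p, sz} \<union> scratch" using writes_body[of h p src] by blast
  then show ?thesis unfolding build_def bfs_def writes.simps
    by (intro Un_least) (simp_all add: scratch_def)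
qed

lemma runs_build:
  fixes h g y n d z
  defines "t \<equiv> (if h then H_tree n y d z g else G_tree n y d z g)"
  assumes ok: "names_ok p src" "sz \<in> {''G_size'', ''H_size''}"
    and par: "params src g y n d z s" and g: "\<And>v. g v \<le> 1"
    and d: "4 ^ y \<le> d" and W: "bounded W y n d z" "nodes t + 2 < W"
  shows "runs W (build h p sz src) s (nodes t * 306 + 50)
    (\<lambda>s'. s' sz 0 = nodes t \<and> (\<exists>\<tau>. shaped_tree (nodes t) (s' p) \<tau> \<and> \<tau> 0 = t))"
proof -
  define \<rho> :: label where "\<rho> = (if h then 8 else 6, n, 0, 0)"
  have t: "tree_of h g y n d z \<rho> = t"
    by (simp add: t_def \<rho>_def tree_of_roots)
  have src: "src \<notin> scratch" using ok by (auto simp: names_ok_def scratch_def)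
  have W': "8 < W" "n < W" "1 < W" "0 < W" using W by (auto simp: bounded_def)
  have v: "valid y n d z \<rho>" by (simp add: valid_def \<rho>_def)
  let ?Q = "\<lambda>s'. params src g y n d z s' \<and> s' ''h'' 0 = 0 \<and> s' ''l'' 0 = 1 \<and> labs s' 0 = \<rho>"
  show ?thesis unfolding build_def
  proof (rule runs_mono)
    show "runs W (Seq (Seq (assign ''h'' (Num 0)) (Seq (assign ''l'' (Num 1))
     (Seq (assign ''k'' (Num (if h then 8 else 6))) (Seq (assign ''j'' (V ''n''))
     (Seq (assign ''x'' (Num 0)) (assign ''m'' (Num 0)))))))
     (Seq (bfs h p src) (assign sz (V ''l'')))) s
      (max_cost (Seq (assign ''h'' (Num 0)) (Seq (assign ''l'' (Num 1))
     (Seq (assign ''k'' (Num (if h then 8 else 6))) (Seq (assign ''j'' (V ''n''))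
     (Seq (assign ''x'' (Num 0)) (assign ''m'' (Num 0))))))) + ((nodes t * 306 + 6) + max_cost (assign sz (V ''l''))))
     (\<lambda>s'. s' sz 0 = nodes t \<and> (\<exists>\<tau>. shaped_tree (nodes t) (s' p) \<tau> \<and> \<tau> 0 = t))"
    proof (rule runs_Seq[OF vc_runs, where Q = ?Q], goal_cases)
      case 1
      show ?case using par W' src by (simp add: params_def scratch_def labs_def \<rho>_def)
    next
      case (2 s')
      show ?case
      proof (rule runs_Seq)
        show "runs W (bfs h p src) s' (nodes t * 306 + 6)
          (\<lambda>s'. s' ''l'' 0 = nodes t \<and> (\<exists>\<tau>. shaped_tree (nodes t) (s' p) \<tau> \<and> \<tau> 0 = t))"
          by (rule runs_bfs[where \<rho> = \<rho> and h = h and g = g and y = y and n = n and d = d and z = z, unfolded t])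
            (use 2 ok g d W v in auto)
        fix s'' assume "s'' ''l'' 0 = nodes t \<and> (\<exists>\<tau>. shaped_tree (nodes t) (s'' p) \<tau> \<and> \<tau> 0 = t)"
        moreover have "p \<noteq> sz" using ok by (auto simp: names_ok_def)
        ultimately show "runs W (assign sz (V ''l'')) s'' (max_cost (assign sz (V ''l'')))
          (\<lambda>s'. s' sz 0 = nodes t \<and> (\<exists>\<tau>. shaped_tree (nodes t) (s' p) \<tau> \<and> \<tau> 0 = t))"
          using W W' by (intro vc_runs) simp
      qed
    qed
  qed simp_all
qed

section \<open>The reduction\<close>

lemma runs_While_vc:
  assumes "\<And>i s. i < n \<Longrightarrow> I i s \<Longrightarrow> bfits W b s \<and> bval b s \<and> vc W c (I (Suc i)) s"
    and "\<And>s. I n s \<Longrightarrow> bfits W b s \<and> \<not> bval b s"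
    and "I 0 s" and "1 + bcost b + max_cost c \<le> C"
  shows "runs W (While b c) s (n * C + C) (I n)"
proof (rule runs_mono[OF runs_While[where I = I and n = n]])
  show "bfits W b s \<and> bval b s \<and> runs W c s (max_cost c) (I (Suc i))" if "i < n" "I i s" for i s
    using assms(1)[OF that] vc_runs by blast
  show "n * (1 + bcost b + max_cost c) + (1 + bcost b) \<le> n * C + C"
    using assms(4) by (intro add_mono mult_le_mono2) auto
qed (use assms in auto)

section \<open>Arithmetic by counting, repeated addition and doubling\<close>

definition incr :: "string \<Rightarrow> com" where
  "incr x = assign x (Add (V x) (Num 1))"

definition product :: com where
  "product = While (Less (V ''i'') (V ''D'')) (Seq (assign ''z'' (Add (V ''z'') (V ''N''))) (incr ''i''))"

lemma runs_product:
  assumes "s ''i'' 0 = 0" "s ''z'' 0 = 0" "s ''D'' 0 = d" "s ''N'' 0 = N" "d * N + N + d + 1 < W"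
  shows "runs W product s (d * 100 + 100) (\<lambda>s'. s' ''z'' 0 = d * N)"
proof -
  define I where "I k s \<longleftrightarrow> s ''i'' 0 = k \<and> s ''z'' 0 = k * N \<and> s ''D'' 0 = d \<and> s ''N'' 0 = N"
    for k and s :: state
  have "runs W product s (d * 100 + 100) (I d)"
    unfolding product_def
  proof (rule runs_While_vc[where I = I and n = d])
    fix k s assume k: "k < d" and I: "I k s"
    have "k * N \<le> d * N" using k by (intro mult_le_mono1) simp
    then have "k * N + N < W" "k * N < W" "N < W" "d < W" "Suc k < W" using assms(5) k by linarith+
    then show "bfits W (Less (V ''i'') (V ''D'')) s \<and> bval (Less (V ''i'') (V ''D'')) s \<and>
      vc W (Seq (assign ''z'' (Add (V ''z'') (V ''N''))) (incr ''i'')) (I (Suc k)) s"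
      using k I assms(5) by (simp add: I_def incr_def)
  qed (use assms in \<open>auto simp: I_def incr_def\<close>)
  then show ?thesis by (rule runs_mono) (auto simp: I_def)
qed

definition halve :: com where
  "halve = While (Less (Add (V ''y'') (V ''y'')) (V ''t'')) (incr ''y'')"

lemma runs_halve:
  assumes "s ''y'' 0 = 0" "s ''t'' 0 = 2 * y" "2 * y + 1 < W"
  shows "runs W halve s (y * 100 + 100) (\<lambda>s'. s' ''y'' 0 = y)"
proof -
  define I where "I k s \<longleftrightarrow> s ''y'' 0 = k \<and> s ''t'' 0 = 2 * y" for k and s :: state
  have "runs W halve s (y * 100 + 100) (I y)"
    unfolding halve_def
    by (rule runs_While_vc[where I = I and n = y]) (use assms in \<open>auto simp: I_def incr_def\<close>)
  then show ?thesis by (rule runs_mono) (auto simp: I_def)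
qed

definition logarithm :: com where
  "logarithm = Seq (Seq (assign ''n'' (Num 1)) (assign ''M'' (Num 2)))
     (While (Less (V ''M'') (V ''N'')) (Seq (assign ''M'' (Add (V ''M'') (V ''M''))) (incr ''n'')))"

lemma runs_logarithm:
  assumes "s ''N'' 0 = N" "N \<le> 2 ^ Suc e" "\<And>k. k < e \<Longrightarrow> 2 ^ Suc k < N" "2 * N + 2 + e < W"
  shows "runs W logarithm s (e * 100 + 200) (\<lambda>s'. s' ''n'' 0 = Suc e)"
proof -
  define I where "I k s \<longleftrightarrow> s ''n'' 0 = Suc k \<and> s ''M'' 0 = 2 ^ Suc k \<and> s ''N'' 0 = N"
    for k and s :: state
  \<comment> \<open>The last power computed is 2 or less than \<open>2 * N\<close>, because the
    power before it was still below \<open>N\<close>.\<close>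
  have e: "2 ^ Suc e < W"
  proof (cases e)
    case (Suc k)
    then show ?thesis using assms(3)[of k] assms(4) by simp
  qed (use assms in simp)
  have "runs W logarithm s (max_cost (Seq (assign ''n'' (Num 1)) (assign ''M'' (Num 2))) + (e * 100 + 100)) (I e)"
    unfolding logarithm_def
  proof (rule runs_Seq[OF vc_runs, where Q = "I 0"])
    show "vc W (Seq (assign ''n'' (Num 1)) (assign ''M'' (Num 2))) (I 0) s"
      using assms by (simp add: I_def)
    fix s assume "I 0 s"
    then show "runs W (While (Less (V ''M'') (V ''N'')) (Seq (assign ''M'' (Add (V ''M'') (V ''M''))) (incr ''n'')))
      s (e * 100 + 100) (I e)"
    proof (rule runs_While_vc[where I = I and n = e, rotated 2])
      fix k s assume k: "k < e" and I: "I k s"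
      then show "bfits W (Less (V ''M'') (V ''N'')) s \<and> bval (Less (V ''M'') (V ''N'')) s \<and>
        vc W (Seq (assign ''M'' (Add (V ''M'') (V ''M''))) (incr ''n'')) (I (Suc k)) s"
        using assms(3)[OF k] assms(4) by (simp add: I_def incr_def)
    qed (use assms e in \<open>auto simp: I_def incr_def\<close>)
  qed
  then show ?thesis by (rule runs_mono) (auto simp: I_def)
qed

section \<open>The invariance test\<close>

definition canon_table :: com where
  "canon_table =
     (let e = V ''e''; e4 = Add (Add e e) (Add e e); w = Get ''c'' e; w4 = Add (Add w w) (Add w w) in
     While (Less e (V ''D''))
       (Seq (assign ''w'' w4)
       (Seq (Put ''c'' e4 (V ''w''))
       (Seq (Put ''c'' (Add e4 (Num 1)) (Add (V ''w'') (Num 1)))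
       (Seq (Put ''c'' (Add e4 (Num 2)) (V ''w''))
       (Seq (Put ''c'' (Add e4 (Num 3)) (Add (V ''w'') (Num 1)))
       (incr ''e''))))))) "

lemma less_4_times_Suc:
  fixes v k :: nat
  assumes "v < 4 * Suc k"
  shows "v < 4 * k \<or> v = 4 * k \<or> v = 4 * k + 1 \<or> v = 4 * k + 2 \<or> v = 4 * k + 3"
  using assms by presburger

lemma runs_canon_table:
  assumes "s ''e'' 0 = 0" "s ''c'' 0 = 0" "s ''D'' 0 = d" "8 * d + 8 < W"
  shows "runs W canon_table s (d * 100 + 100) (\<lambda>s'. \<forall>v<d. s' ''c'' v = canon v)"
proof -
  define I where "I k s \<longleftrightarrow> s ''e'' 0 = k \<and> s ''D'' 0 = d \<and> s ''c'' 0 = 0 \<and>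
    (\<forall>v<4 * k. s ''c'' v = canon v)" for k and s :: state
  have "runs W canon_table s (d * 100 + 100) (I d)"
    unfolding canon_table_def Let_def
  proof (rule runs_While_vc[where I = I and n = d], goal_cases)
    case (1 k s)
    \<comment> \<open>Cell \<open>k\<close> has been filled already: \<open>k < 4 * k\<close> for
      positive \<open>k\<close>, and cell 0 holds 0 from the start.\<close>
    have ck: "s ''c'' k = canon k" using 1(2) by (cases k) (auto simp: I_def)
    have le: "canon k \<le> k" by (rule canon_le)
    have s: "s ''e'' 0 = k" "s ''D'' 0 = d" "s ''c'' 0 = 0" "\<And>v. v < 4 * k \<Longrightarrow> s ''c'' v = canon v"
      using 1(2) by (auto simp: I_def)
    have e4: "k + k + (k + k) = 4 * k" "canon k + canon k + (canon k + canon k) = 4 * canon k" by simp_all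
    have W: "k < W" "4 * k + 3 < W" "d < W" "canon k < W" "4 * canon k + 1 < W" "3 < W"
      "k + k < W" "canon k + canon k < W" using le 1(1) assms(4) by auto
    define c' where "c' = (s ''c'')(4 * k := 4 * canon k, 4 * k + 1 := 4 * canon k + 1,
      4 * k + 2 := 4 * canon k, 4 * k + 3 := 4 * canon k + 1)"
    have new: "c' v = canon v" if "v < 4 * Suc k" for v
      using less_4_times_Suc[OF that] s(4)[of v] canon_4[of k] by (auto simp: c'_def)
    have "vc W (Seq (assign ''w'' (Add (Add (Get ''c'' (V ''e'')) (Get ''c'' (V ''e'')))
         (Add (Get ''c'' (V ''e'')) (Get ''c'' (V ''e'')))))
       (Seq (Put ''c'' (Add (Add (V ''e'') (V ''e'')) (Add (V ''e'') (V ''e''))) (V ''w''))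
       (Seq (Put ''c'' (Add (Add (Add (V ''e'') (V ''e'')) (Add (V ''e'') (V ''e''))) (Num 1)) (Add (V ''w'') (Num 1)))
       (Seq (Put ''c'' (Add (Add (Add (V ''e'') (V ''e'')) (Add (V ''e'') (V ''e''))) (Num 2)) (V ''w''))
       (Seq (Put ''c'' (Add (Add (Add (V ''e'') (V ''e'')) (Add (V ''e'') (V ''e''))) (Num 3)) (Add (V ''w'') (Num 1)))
       (incr ''e''))))))
       (\<lambda>s'. s' ''e'' 0 = Suc k \<and> s' ''D'' 0 = d \<and> s' ''c'' = c') s" (is "vc W ?c _ s")
      using 1(1) W s ck by (simp add: incr_def e4 c'_def)
    then have "vc W ?c (I (Suc k)) s"
      by (rule vc_mono) (use new in \<open>auto simp: I_def\<close>)
    then show ?case using W s 1(1) by simp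
  next
    case (2 s) then show ?case using assms by (simp add: I_def)
  next
    case 3 then show ?case using assms by (simp add: I_def)
  next
    case 4 then show ?case by (simp add: incr_def)
  qed
  then show ?thesis by (rule runs_mono) (auto simp: I_def)
qed

text \<open>Cell \<open>a\<close> is the base address of the current tensor and cell
  \<open>b\<close> the offset in it; maintaining both avoids division. Equality is tested by two
  comparisons.\<close>

definition test :: com where
  "test =
     (let v = Get ''A'' (Add (V ''a'') (V ''b'')); w = Get ''A'' (Add (V ''a'') (Get ''c'' (V ''b''))) in
     Seq (assign ''f'' (Num 1))
     (While (Less (V ''a'') (V ''z''))
       (Seq (Cond (Conj (Neg (Less v w)) (Neg (Less w v))) Skip (assign ''f'' (Num 0)))
       (Seq (incr ''b'')
       (Cond (Less (V ''b'') (V ''D'')) Skip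
         (Seq (assign ''b'' (Num 0)) (assign ''a'' (Add (V ''a'') (V ''D'')))))))))"

lemma canonical_flat:
  assumes "0 < d"
  shows "canonical N d g \<longleftrightarrow> (\<forall>k<N * d. g k = g (k div d * d + canon (k mod d)))"
proof
  assume c: "canonical N d g"
  show "\<forall>k<N * d. g k = g (k div d * d + canon (k mod d))"
  proof (intro allI impI)
    fix k assume "k < N * d"
    then have "k div d < N" "k mod d < d" using assms by (auto simp: less_mult_imp_div_less)
    then have "g (k div d * d + k mod d) = g (k div d * d + canon (k mod d))"
      using c by (simp only: canonical_def)
    then show "g k = g (k div d * d + canon (k mod d))" by simp
  qed
next
  assume c: "\<forall>k<N * d. g k = g (k div d * d + canon (k mod d))"
  show "canonical N d g"
    unfolding canonical_def
  proof (intro allI impI)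
    fix i m assume im: "i < N" "m < d"
    have "i * d + m < Suc i * d" using im by simp
    also have "\<dots> \<le> N * d" using im by (intro mult_le_mono1) simp
    finally show "g (i * d + m) = g (i * d + canon m)" using c im by (auto simp: div_add1_eq)
  qed
qed

lemma runs_test:
  assumes s: "s ''a'' 0 = 0" "s ''b'' 0 = 0" "s ''D'' 0 = d" "s ''z'' 0 = N * d" "s ''A'' = g"
    "\<forall>v<d. s ''c'' v = canon v"
    and d: "0 < d" and g: "\<And>v. g v \<le> 1" and W: "N * d + 2 * d + 2 < W"
  shows "runs W test s (N * d * 100 + 200) (\<lambda>s'. s' ''f'' 0 = of_bool (canonical N d g))"
proof -
  define C where "C k \<longleftrightarrow> (\<forall>k'<k. g k' = g (k' div d * d + canon (k' mod d)))" for k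
  define I where "I k s \<longleftrightarrow> s ''a'' 0 = k div d * d \<and> s ''b'' 0 = k mod d \<and> s ''D'' 0 = d \<and>
     s ''z'' 0 = N * d \<and> s ''A'' = g \<and> (\<forall>v<d. s ''c'' v = canon v) \<and> s ''f'' 0 = of_bool (C k)"
    for k and s :: state
  have "runs W test s (max_cost (assign ''f'' (Num 1)) + (N * d * 100 + 100)) (I (N * d))"
    unfolding test_def Let_def
  proof (rule runs_Seq[OF vc_runs, where Q = "I 0"], goal_cases)
    case 1
    show ?case using s W by (simp add: I_def C_def)
  next
    case (2 s)
    then show ?case
    proof (rule runs_While_vc[where I = I and n = "N * d", rotated 2], goal_cases)
      case 1 show ?case by (simp add: incr_def)
    next
      case (2 k s)
      have k: "k div d < N" "k mod d < d" using 2(1) d by (auto simp: less_mult_imp_div_less)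
      have kd: "k div d * d + k mod d = k" by simp
      have a: "k div d * d < N * d" using k d by simp
      have cm: "canon (k mod d) \<le> k mod d" by (rule canon_le)
      have st: "s ''a'' 0 = k div d * d" "s ''b'' 0 = k mod d" "s ''D'' 0 = d" "s ''z'' 0 = N * d"
        "s ''A'' = g" "s ''c'' (k mod d) = canon (k mod d)" "s ''f'' 0 = of_bool (C k)"
        "\<forall>v<d. s ''c'' v = canon v"
        using 2(2) k by (auto simp: I_def)
      have W': "k div d * d < W" "k mod d < W" "k < W" "k div d * d + canon (k mod d) < W"
        "N * d < W" "d < W" "0 < W" "1 < W" "canon (k mod d) < W" "g v < W" "Suc (k mod d) < W"
        "k div d * d + d < W" for v
        using W a k cm g[of v] 2(1) by linarith+
      have CS: "C (Suc k) \<longleftrightarrow> C k \<and> g k = g (k div d * d + canon (k mod d))"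
        by (auto simp: C_def less_Suc_eq)
      have lt: "Suc (k mod d) < d \<longleftrightarrow> Suc (k mod d) \<noteq> d" using k by linarith
      \<comment> \<open>If \<open>Suc (k mod d) = d\<close>, the offset wraps around and the base
        moves to the next tensor.\<close>
      show ?case using W' a
        by (cases "Suc (k mod d) = d"; cases "C k")
          (auto simp: st kd lt CS I_def incr_def mod_Suc div_Suc)
    next
      case (3 s)
      then show ?case using W d by (simp add: I_def)
    qed
  qed
  then show ?thesis
    by (rule runs_mono) (auto simp: I_def C_def canonical_flat[OF d])
qed

definition prelude :: com where
  "prelude = Seq product (Seq halve (Seq logarithm (Seq canon_table test)))"

lemma writes_prelude:
  "writes product = {''z'', ''i''}" "writes halve = {''y''}" "writes logarithm = {''n'', ''M''}"
  "writes canon_table = {''w'', ''c'', ''e''}" "writes test = {''f'', ''b'', ''a''}"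
  by (auto simp only: product_def halve_def logarithm_def canon_table_def test_def incr_def Let_def writes.simps)

lemma runs_prelude:
  assumes z: "\<And>x. x \<in> {''i'', ''z'', ''y'', ''c'', ''e'', ''a'', ''b''} \<Longrightarrow> s x 0 = 0"
    and s: "s ''t'' 0 = 2 * y" "s ''D'' 0 = d" "s ''N'' 0 = N" "s ''A'' = g" and g: "\<And>v. g v \<le> 1"
    and e: "N \<le> 2 ^ Suc e" "\<And>k. k < e \<Longrightarrow> 2 ^ Suc k < N"
    and W: "d * N + N + d + 1 < W" "2 * y + 1 < W" "2 * N + 2 + e < W" "8 * d + 8 < W"
      "N * d + 2 * d + 2 < W" and d: "0 < d"
  shows "runs W prelude s (d * 200 + y * 100 + e * 100 + N * d * 100 + 700)
    (\<lambda>s'. s' ''y'' 0 = y \<and> s' ''n'' 0 = Suc e \<and> s' ''z'' 0 = N * d \<and>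
       s' ''f'' 0 = of_bool (canonical N d g))"
proof -
  let ?Q = "\<lambda>s'. s' ''y'' 0 = y \<and> s' ''n'' 0 = Suc e \<and> s' ''z'' 0 = N * d \<and>
       s' ''f'' 0 = of_bool (canonical N d g)"
  have "runs W prelude s ((d * 100 + 100) + ((y * 100 + 100) + ((e * 100 + 200) +
      ((d * 100 + 100) + (N * d * 100 + 200))))) ?Q"
    unfolding prelude_def
  proof (rule runs_Seq[OF runs_frame])
    show "runs W product s (d * 100 + 100) (\<lambda>s'. s' ''z'' 0 = d * N)"
      by (rule runs_product) (use z s W in auto)
    fix s1 assume "s1 ''z'' 0 = d * N \<and> (\<forall>x. x \<notin> writes product \<longrightarrow> s1 x = s x)"
    note f1 = this[unfolded writes_prelude]
    show "runs W (Seq halve (Seq logarithm (Seq canon_table test))) s1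
      ((y * 100 + 100) + ((e * 100 + 200) + ((d * 100 + 100) + (N * d * 100 + 200)))) ?Q"
    proof (rule runs_Seq[OF runs_frame])
      show "runs W halve s1 (y * 100 + 100) (\<lambda>s'. s' ''y'' 0 = y)"
        by (rule runs_halve) (use f1 z s W in auto)
      fix s2 assume "s2 ''y'' 0 = y \<and> (\<forall>x. x \<notin> writes halve \<longrightarrow> s2 x = s1 x)"
      note f2 = this[unfolded writes_prelude]
      show "runs W (Seq logarithm (Seq canon_table test)) s2
        ((e * 100 + 200) + ((d * 100 + 100) + (N * d * 100 + 200))) ?Q"
      proof (rule runs_Seq[OF runs_frame])
        show "runs W logarithm s2 (e * 100 + 200) (\<lambda>s'. s' ''n'' 0 = Suc e)"
          by (rule runs_logarithm[OF _ e W(3)]) (use f1 f2 s in auto)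
        fix s3 assume "s3 ''n'' 0 = Suc e \<and> (\<forall>x. x \<notin> writes logarithm \<longrightarrow> s3 x = s2 x)"
        note f3 = this[unfolded writes_prelude]
        show "runs W (Seq canon_table test) s3 ((d * 100 + 100) + (N * d * 100 + 200)) ?Q"
        proof (rule runs_Seq[OF runs_frame])
          show "runs W canon_table s3 (d * 100 + 100) (\<lambda>s'. \<forall>v<d. s' ''c'' v = canon v)"
            by (rule runs_canon_table) (use f1 f2 f3 z s W in auto)
          fix s4 assume "(\<forall>v<d. s4 ''c'' v = canon v) \<and> (\<forall>x. x \<notin> writes canon_table \<longrightarrow> s4 x = s3 x)"
          note f4 = this[unfolded writes_prelude]
          have "runs W test s4 (N * d * 100 + 200) (\<lambda>s'. s' ''f'' 0 = of_bool (canonical N d g))"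
            by (rule runs_test) (use f1 f2 f3 f4 z s W g d in \<open>auto simp: mult.commute\<close>)
          from runs_frame[OF this] show "runs W test s4 (N * d * 100 + 200) ?Q"
            by (rule runs_mono) (use f1 f2 f3 f4 in \<open>auto simp: writes_prelude mult.commute\<close>)
        qed
      qed
    qed
  qed
  then show ?thesis by (rule runs_mono) simp_all
qed

section \<open>The complete reduction and its bounds\<close>

definition build_pair :: "string \<Rightarrow> string \<Rightarrow> com" where
  "build_pair u v =
     Seq (build False ''G_parent'' ''G_size'' u) (build True ''H_parent'' ''H_size'' v)"

text \<open>If the test fails for \<open>A\<close>, then \<open>B\<close> is the invariant set and
  supplies the tree \<open>G\<close> instead.\<close>

definition reduction :: com where
  "reduction = Seq prelude
     (Cond (Less (Num 0) (V ''f'')) (build_pair ''A'' ''B'') (build_pair ''B'' ''A''))"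

definition solved :: "nat \<Rightarrow> nat \<Rightarrow> nat \<Rightarrow> nat \<Rightarrow> (nat \<Rightarrow> nat) \<Rightarrow> (nat \<Rightarrow> nat) \<Rightarrow> state \<Rightarrow> bool" where
  "solved n y d z f g s \<longleftrightarrow>
     (\<exists>\<tau> \<sigma>. s ''G_size'' 0 = nodes (G_tree n y d z f) \<and> s ''H_size'' 0 = nodes (H_tree n y d z g) \<and>
       shaped_tree (s ''G_size'' 0) (s ''G_parent'') \<tau> \<and> \<tau> 0 = G_tree n y d z f \<and>
       shaped_tree (s ''H_size'' 0) (s ''H_parent'') \<sigma> \<and> \<sigma> 0 = H_tree n y d z g)"

lemma runs_build_pair:
  assumes uv: "u \<in> {''A'', ''B''}" "v \<in> {''A'', ''B''}"
    and par: "params u f y n d z s" "params v g y n d z s"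
    and fg: "\<And>i. f i \<le> 1" "\<And>i. g i \<le> 1"
    and d: "4 ^ y \<le> d" and W: "bounded W y n d z"
    and K: "nodes (G_tree n y d z f) \<le> K" "nodes (H_tree n y d z g) \<le> K" "K + 2 < W"
  shows "runs W (build_pair u v) s (K * 612 + 100) (solved n y d z f g)"
proof -
  have ok: "names_ok ''G_parent'' u" "names_ok ''H_parent'' v" using uv by (auto simp: names_ok_def)
  have 1: "runs W (build False ''G_parent'' ''G_size'' u) s (nodes (G_tree n y d z f) * 306 + 50)
    (\<lambda>s'. s' ''G_size'' 0 = nodes (G_tree n y d z f) \<and>
      (\<exists>\<tau>. shaped_tree (nodes (G_tree n y d z f)) (s' ''G_parent'') \<tau> \<and> \<tau> 0 = G_tree n y d z f))"
    using runs_build[where h = False, OF ok(1) _ par(1) fg(1) d W, of "''G_size''"] K by simp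
  have 2: "runs W (build True ''H_parent'' ''H_size'' v) s1 (nodes (H_tree n y d z g) * 306 + 50)
    (\<lambda>s'. s' ''H_size'' 0 = nodes (H_tree n y d z g) \<and>
      (\<exists>\<tau>. shaped_tree (nodes (H_tree n y d z g)) (s' ''H_parent'') \<tau> \<and> \<tau> 0 = H_tree n y d z g))"
    if "params v g y n d z s1" for s1
    using runs_build[where h = True, OF ok(2) _ that fg(2) d W, of "''H_size''"] K by simp
  \<comment> \<open>The first call must leave the input and the parameters intact, the second one
    the tree written by the first.\<close>
  have fr1: "x \<notin> writes (build False ''G_parent'' ''G_size'' u)" if "x \<in> {''A'', ''B'', ''y'', ''n'', ''D'', ''z''}" for x
    using writes_build[of False "''G_parent''" "''G_size''" u] that by (auto simp: scratch_def)
  have fr2: "x \<notin> writes (build True ''H_parent'' ''H_size'' v)" if "x \<in> {''G_size'', ''G_parent''}" for x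
    using writes_build[of True "''H_parent''" "''H_size''" v] that by (auto simp: scratch_def)
  have "runs W (build_pair u v) s
      ((nodes (G_tree n y d z f) * 306 + 50) + (nodes (H_tree n y d z g) * 306 + 50)) (solved n y d z f g)"
    unfolding build_pair_def
  proof (rule runs_Seq[OF runs_frame[OF 1]], goal_cases)
    case (1 s1)
    have "params v g y n d z s1"
      using par(2) 1 fr1 uv by (auto simp: params_def)
    from runs_frame[OF 2[OF this]] show ?case
    proof (rule runs_mono, goal_cases)
      case (2 s2)
      then have "s2 ''G_size'' = s1 ''G_size''" "s2 ''G_parent'' = s1 ''G_parent''"
        using fr2 by auto
      then show ?case using 1 2 unfolding solved_def by auto
    qed simp
  qed
  then show ?thesis by (rule runs_mono) (use K in simp_all)
qed

lemma solved_output: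
  assumes s: "solved n y d z f g s" and r: "s ''G_root'' 0 = 0" "s ''H_root'' 0 = 0" and n: "0 < n"
  shows "binary_tree (output_G s)" "binary_tree (output_H s)"
    "card (verts (output_G s)) = nodes (G_tree n y d z f)"
    "card (verts (output_H s)) = nodes (H_tree n y d z g)"
    "depth (output_G s) \<le> 2 * n + 3 * y + 4" "depth (output_H s) \<le> 2 * n + 3 * y + 4"
    "rooted_subtree_iso (output_G s) (output_H s) \<longleftrightarrow> emb (G_tree n y d z f) (H_tree n y d z g)"
    "unrooted_subtree_iso (output_G s) (output_H s) \<longleftrightarrow> emb (G_tree n y d z f) (H_tree n y d z g)"
proof -
  obtain \<tau> \<sigma> where sz: "s ''G_size'' 0 = nodes (G_tree n y d z f)" "s ''H_size'' 0 = nodes (H_tree n y d z g)"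
    and G: "shaped_tree (s ''G_size'' 0) (s ''G_parent'') \<tau>" "\<tau> 0 = G_tree n y d z f"
    and H: "shaped_tree (s ''H_size'' 0) (s ''H_parent'') \<sigma>" "\<sigma> 0 = H_tree n y d z g"
    using s unfolding solved_def by blast
  interpret tree_pair "s ''G_size'' 0" "s ''G_parent''" \<tau> "s ''H_size'' 0" "s ''H_parent''" \<sigma>
    by (intro tree_pair.intro G H)
  have o: "output_G s = G.gr" "output_H s = H.gr" by (simp_all add: output_G_def output_H_def r)
  show "binary_tree (output_G s)" "binary_tree (output_H s)"
    unfolding o by (rule G.binary_gr H.binary_gr)+
  show "card (verts (output_G s)) = nodes (G_tree n y d z f)"
    "card (verts (output_H s)) = nodes (H_tree n y d z g)"
    by (simp_all add: o sz[symmetric])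
  show "depth (output_G s) \<le> 2 * n + 3 * y + 4" "depth (output_H s) \<le> 2 * n + 3 * y + 4"
    using G.depth_less_height H.depth_less_height unfolding o G H height_G_tree height_H_tree by simp_all
  show 1: "rooted_subtree_iso (output_G s) (output_H s) \<longleftrightarrow> emb (G_tree n y d z f) (H_tree n y d z g)"
    unfolding o using rooted_iff_emb by (simp add: G H)
  obtain l r where "G_tree n y d z f = Node l r" "l \<noteq> Empty" "r \<noteq> Empty"
    "height l = 2 * n + 3 * y + 4" "height r = 2 * n + 3 * y + 4"
    using G_tree_root[OF n] by metis
  then have "unrooted_subtree_iso (output_G s) (output_H s) \<longleftrightarrow> rooted_subtree_iso (output_G s) (output_H s)"
    unfolding o by (intro unrooted_iff_rooted[of l r]) (auto simp: G H height_H_tree)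
  then show "unrooted_subtree_iso (output_G s) (output_H s) \<longleftrightarrow> emb (G_tree n y d z f) (H_tree n y d z g)"
    using 1 by simp
qed

lemma card_tensors: "finite (tensors t)" "card (tensors t) = 2 ^ 2 ^ t"
proof -
  have i: "finite (indices t)" "card (indices t) = 2 ^ t"
    using finite_lists_length_eq[of "UNIV :: bool set" t] card_lists_length_eq[of "UNIV :: bool set" t]
    by (simp_all add: indices_def)
  show "finite (tensors t)" unfolding tensors_def using i by (intro finite_PiE) auto
  show "card (tensors t) = 2 ^ 2 ^ t" unfolding tensors_def using i by (simp add: card_funcsetE)
qed

text \<open>The constant 30000 is generous and serves at once for time, size, word bound and
  depth.\<close>

lemma reduction_correct:
  assumes inst: "restricted_OAPT_instance t N A B" and en: "enumerates us A" "enumerates vs B"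
    and W: "30000 * (N * 2 ^ t) \<le> W"
  shows "runs W reduction (input_state t us vs) (30000 * (N * 2 ^ t)) (\<lambda>s.
     binary_tree (output_G s) \<and> binary_tree (output_H s) \<and>
     card (verts (output_G s)) \<le> 30000 * (N * 2 ^ t) \<and> card (verts (output_H s)) \<le> 30000 * (N * 2 ^ t) \<and>
     real (depth (output_G s)) \<le> 2 * log 2 (real N) + 30000 * real t \<and>
     real (depth (output_H s)) \<le> 2 * log 2 (real N) + 30000 * real t \<and>
     (OAPT t A B \<longleftrightarrow> rooted_subtree_iso (output_G s) (output_H s)) \<and>
     (OAPT t A B \<longleftrightarrow> unrooted_subtree_iso (output_G s) (output_H s)))" (is "runs _ _ ?s _ ?P")
proof -
  define d where "d = (2::nat) ^ t"
  define y where "y = t div 2"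
  define q where "q = N * d"
  have t: "t = 2 * y" "1 \<le> y" and N: "1 \<le> N" and AB: "A \<subseteq> tensors t" "card A = N" "card B = N"
    using inst by (auto simp: restricted_OAPT_instance_def y_def)
  have us: "set us = A" "length us = N" "set vs = B" "length vs = N"
    using en AB by (auto simp: enumerates_def distinct_card[symmetric])
  have d4: "d = 4 ^ y" by (simp add: d_def t(1) power_mult)
  have d: "4 \<le> d" using power_increasing[OF t(2), of "4::nat"] by (simp add: d4)
  have "t < d" by (simp add: d_def)
  then have yd: "2 * y < d" using t by simp
  have dq: "d \<le> q" "N \<le> q" using N d by (simp_all add: q_def)
  have "\<exists>k. N \<le> 2 ^ Suc k" 
    by (rule exI[of _ N]) (use less_exp[of "Suc N"] in linarith)
  define e where "e = (LEAST k. N \<le> 2 ^ Suc k)"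
  \<comment> \<open>At least 1 even for \<open>N = 1\<close>: the unrooted case needs a root with
    two children.\<close>
  define n where "n = Suc e"
  have e1: "N \<le> 2 ^ Suc e" unfolding e_def by (rule LeastI_ex) fact
  have e2: "2 ^ Suc k < N" if "k < e" for k
    using not_less_Least[of k "\<lambda>k. N \<le> 2 ^ Suc k"] that by (auto simp: e_def)
  have e3: "2 ^ e \<le> N" using e2[of "e - 1"] N by (cases e) auto
  \<comment> \<open>There are only \<open>2 ^ d\<close> tensors. This makes the paths, whose length
    is logarithmic in \<open>N\<close>, no longer than \<open>O(d)\<close>.\<close>
  have "N \<le> 2 ^ d" using card_mono[OF card_tensors(1) AB(1)] AB(2) by (simp add: card_tensors d_def)
  then have "(2::nat) ^ e \<le> 2 ^ d" using e3 by linarith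
  then have ed: "e \<le> d" by simp
  have "real e = log 2 (2 ^ e)" by simp
  also have "\<dots> \<le> log 2 (real N)" using e3 N by (subst log_le_cancel_iff) (auto simp flip: of_nat_le_iff)
  finally have elog: "real e \<le> log 2 (real N)" .
  define K where "K = 32 * q"
  \<comment> \<open>From \<open>2 ^ e \<le> N\<close> follows \<open>2 ^ n \<le> 2 * N\<close>, and
    from \<open>e \<le> d\<close> and \<open>4 \<le> d\<close> follows
    \<open>n + 8 + 12 * d \<le> 13 * d + 9 \<le> 16 * d\<close>.\<close>
  have "2 ^ n * (n + 8 + 12 * 4 ^ y) \<le> (2 * N) * (16 * d)"
    using e3 ed d by (intro mult_le_mono) (auto simp: n_def d4[symmetric])
  then have K': "2 ^ n * (n + 8 + 12 * 4 ^ y) \<le> K" by (simp add: K_def q_def)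
  have K: "nodes (G_tree n y d q f) \<le> K" "nodes (H_tree n y d q f) \<le> K" for f
    using nodes_G_tree[of n y d q f] nodes_H_tree[of n y d q f] K' by simp_all
  have n2: "2 ^ n * d \<le> 2 * q" using e3 by (simp add: n_def q_def)
  have Wq: "30000 * q \<le> W" using W by (simp add: q_def d_def)
  have bd: "bounded W y n d q" using Wq dq d yd ed n2 unfolding bounded_def n_def by linarith
  define f g where "f = tensor_array t us" and "g = tensor_array t vs"
  have fg: "f i \<le> 1" "g i \<le> 1" for i by (simp_all add: f_def g_def tensor_array_def)
  have qq: "d * N = q" "N * d = q" by (simp_all add: q_def)
  have pre: "runs W prelude ?s (d * 200 + y * 100 + e * 100 + N * d * 100 + 700)
    (\<lambda>s'. s' ''y'' 0 = y \<and> s' ''n'' 0 = Suc e \<and> s' ''z'' 0 = N * d \<and> s' ''f'' 0 = of_bool (canonical N d f))"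
  proof (rule runs_prelude)
    show "d * N + N + d + 1 < W" "2 * y + 1 < W" "2 * N + 2 + e < W" "8 * d + 8 < W" "N * d + 2 * d + 2 < W" "0 < d"
      using Wq dq d yd ed unfolding qq by linarith+
  qed (use fg e1 e2 us t in \<open>auto simp: input_state_def f_def d_def\<close>)
  have good: "?P s" if sol: "solved n y d q (tensor_array t us') (tensor_array t vs') s"
     "s ''G_root'' 0 = 0" "s ''H_root'' 0 = 0"
     and c: "canonical N d (tensor_array t us')" "length us' = N" "length vs' = N"
     and eq: "OAPT t A B \<longleftrightarrow> (\<exists>u\<in>set us'. \<exists>v\<in>set vs'. \<not> p_alt t u v)" for us' vs' s
  proof -
    note out = solved_output[OF sol]
    have n: "0 < n" by (simp add: n_def)
    have emb: "emb (G_tree n y d q (tensor_array t us')) (H_tree n y d q (tensor_array t vs')) \<longleftrightarrow> OAPT t A B"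
      unfolding eq q_def d_def by (rule emb_iff_p_alt) (use t c e1 N in \<open>auto simp: n_def d_def\<close>)
    have dep: "real k \<le> 2 * log 2 (real N) + 30000 * real t" if "k \<le> 2 * n + 3 * y + 4" for k
    proof -
      have "real k \<le> real (2 * n + 3 * y + 4)" using that by (simp only: of_nat_le_iff)
      \<comment> \<open>Here \<open>2 * n = 2 * e + 2\<close>, so \<open>3 * y + 6\<close> remains,
        which is linear in \<open>t\<close> because \<open>1 \<le> y\<close>.\<close>
      also have "\<dots> \<le> 2 * log 2 (real N) + 30000 * real t" using elog t by (simp add: n_def)
      finally show ?thesis .
    qed
    have K2: "k \<le> 30000 * (N * 2 ^ t)" if "k \<le> K" for k
      using that by (simp add: K_def q_def d_def)
    show ?thesis
      unfolding out(3,4)[OF n] out(7,8)[OF n] emb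
      by (intro conjI out(1,2)[OF n] K2 K dep out(5,6)[OF n] refl)
  qed
  have post: "runs W (Cond (Less (Num 0) (V ''f'')) (build_pair ''A'' ''B'') (build_pair ''B'' ''A'')) s
      (1 + 4 + (K * 612 + 100)) ?P"
    if s: "s ''y'' 0 = y" "s ''n'' 0 = n" "s ''z'' 0 = q" "s ''f'' 0 = of_bool (canonical N d f)"
      "s ''D'' 0 = d" "s ''A'' = f" "s ''B'' = g" "s ''G_root'' 0 = 0" "s ''H_root'' 0 = 0" for s
  proof (rule runs_mono[OF runs_Cond[where C = "K * 612 + 100"]])
    \<comment> \<open>The root cells are never written. Their initial value 0 is the number that the
      queue gives to the root.\<close>
    have fr: "x \<notin> writes (build_pair u v)" if "x \<in> {''G_root'', ''H_root''}" for x u v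
      using that writes_build[of False "''G_parent''" "''G_size''" u]
        writes_build[of True "''H_parent''" "''H_size''" v]
      by (auto simp: build_pair_def scratch_def)
    have p: "params ''A'' f y n d q s" "params ''B'' g y n d q s" using s by (auto simp: params_def)
    have KW: "K + 2 < W" using Wq dq d by (simp add: K_def)
    have sol: "runs W (build_pair u v) s (K * 612 + 100) ?P"
      if r: "runs W (build_pair u v) s (K * 612 + 100)
          (solved n y d q (tensor_array t us') (tensor_array t vs'))"
        and c: "canonical N d (tensor_array t us')" "length us' = N" "length vs' = N"
          "OAPT t A B \<longleftrightarrow> (\<exists>u\<in>set us'. \<exists>v\<in>set vs'. \<not> p_alt t u v)" for u v us' vs'
      using runs_frame[OF r] order.refl
    proof (rule runs_mono)
      fix s' assume s': "solved n y d q (tensor_array t us') (tensor_array t vs') s' \<and>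
        (\<forall>x. x \<notin> writes (build_pair u v) \<longrightarrow> s' x = s x)"
      then have "s' ''G_root'' 0 = 0" "s' ''H_root'' 0 = 0" using fr s by auto
      then show "?P s'" using good[OF _ _ _ c] s' by blast
    qed
    show "bfits W (Less (Num 0) (V ''f'')) s" using s KW by simp
    show "runs W (build_pair ''A'' ''B'') s (K * 612 + 100) ?P" if "bval (Less (Num 0) (V ''f'')) s"
    proof (rule sol)
      show "runs W (build_pair ''A'' ''B'') s (K * 612 + 100)
          (solved n y d q (tensor_array t us) (tensor_array t vs))"
        by (rule runs_build_pair) (use p[unfolded f_def g_def] fg[unfolded f_def g_def] bd K KW d4 in auto)
      show "canonical N d (tensor_array t us)" using that s by (simp add: f_def)
      show "OAPT t A B \<longleftrightarrow> (\<exists>u\<in>set us. \<exists>v\<in>set vs. \<not> p_alt t u v)" by (simp add: OAPT_def us)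
    qed (use us in auto)
    show "runs W (build_pair ''B'' ''A'') s (K * 612 + 100) ?P" if "\<not> bval (Less (Num 0) (V ''f'')) s"
    proof (rule sol)
      show "runs W (build_pair ''B'' ''A'') s (K * 612 + 100)
          (solved n y d q (tensor_array t vs) (tensor_array t us))"
        by (rule runs_build_pair) (use p[unfolded f_def g_def] fg[unfolded f_def g_def] bd K KW d4 in auto)
      have "\<not> canonical N d f" using that s by simp
      then have "\<not> (\<forall>a\<in>A. and_invariant t a)"
        using and_invariant_canonical[of t us] t us by (auto simp: f_def d_def)
      then show "canonical N d (tensor_array t vs)"
        using and_invariant_canonical[of t vs] t us inst
        by (auto simp: restricted_OAPT_instance_def d_def)
      show "OAPT t A B \<longleftrightarrow> (\<exists>u\<in>set vs. \<exists>v\<in>set us. \<not> p_alt t u v)"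
        unfolding OAPT_def us by (metis p_alt_commute)
    qed (use us in auto)
  qed (assumption | simp)+
  show ?thesis unfolding reduction_def
  proof (rule runs_mono[OF runs_Seq[OF runs_frame[OF pre]]])
    fix s assume s: "(s ''y'' 0 = y \<and> s ''n'' 0 = Suc e \<and> s ''z'' 0 = N * d \<and>
        s ''f'' 0 = of_bool (canonical N d f)) \<and> (\<forall>x. x \<notin> writes prelude \<longrightarrow> s x = ?s x)"
    have "x \<notin> writes prelude" if "x \<in> {''D'', ''A'', ''B'', ''G_root'', ''H_root''}" for x
      using that by (auto simp: prelude_def writes_prelude)
    then have "s ''D'' = ?s ''D''" "s ''A'' = ?s ''A''" "s ''B'' = ?s ''B''"
      "s ''G_root'' = ?s ''G_root''" "s ''H_root'' = ?s ''H_root''" using s by auto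
    then show "runs W (Cond (Less (Num 0) (V ''f'')) (build_pair ''A'' ''B'') (build_pair ''B'' ''A'')) s
      (1 + 4 + (K * 612 + 100)) ?P"
      using s by (intro post) (simp_all add: input_state_def f_def g_def d_def n_def q_def)
  next
    \<comment> \<open>Building the trees dominates with \<open>612 * 32 = 19584\<close> steps per
      unit of \<open>q\<close>; all the rest is linear in \<open>q\<close> with small
      factors.\<close>
    have "d * 200 + y * 100 + e * 100 + q * 100 + 700 + (1 + 4 + (K * 612 + 100)) \<le> 30000 * q"
      using dq d yd ed unfolding K_def by linarith
    then show "d * 200 + y * 100 + e * 100 + N * d * 100 + 700 + (1 + 4 + (K * 612 + 100)) \<le> 30000 * (N * 2 ^ t)"
      by (simp add: q_def d_def)
  qed
qed

theorem theorem8p4: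
  fixes Subtree_Iso :: "nat rooted_graph \<Rightarrow> nat rooted_graph \<Rightarrow> bool"
  assumes "Subtree_Iso \<in> {rooted_subtree_iso, unrooted_subtree_iso}"
  shows "\<exists>(P :: com) (c :: nat) (k :: nat).
    \<forall>(t :: nat) (N :: nat) (D :: nat) (A :: tensor set) (B :: tensor set) as bs.
      restricted_OAPT_instance t N A B \<and> D = 2 ^ t \<and> enumerates as A \<and> enumerates bs B \<longrightarrow>
      (\<exists>T s G H.
         exec (c * (N * D) ^ k) P (input_state t as bs) T s \<and>
         T \<le> c * N * D ^ k \<and>
         G = output_G s \<and> H = output_H s \<and>
         binary_tree G \<and> binary_tree H \<and>
         card (verts G) \<le> c * N * D ^ k \<and> card (verts H) \<le> c * N * D ^ k \<and>
         real (depth G) \<le> 2 * log 2 (real N) + real c * log 2 (real D) \<and>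
         real (depth H) \<le> 2 * log 2 (real N) + real c * log 2 (real D) \<and>
         (OAPT t A B \<longleftrightarrow> Subtree_Iso G H))"
proof (rule exI[of _ reduction], rule exI[of _ 30000], rule exI[of _ 1], intro allI impI, elim conjE)
  fix t N D :: nat and A B :: "tensor set" and as bs
  assume inst: "restricted_OAPT_instance t N A B" "enumerates as A" "enumerates bs B" and D: "D = 2 ^ t"
  have l: "log 2 (real D) = real t" by (simp add: D)
  show "\<exists>T s G H.
         exec (30000 * (N * D) ^ 1) reduction (input_state t as bs) T s \<and>
         T \<le> 30000 * N * D ^ 1 \<and>
         G = output_G s \<and> H = output_H s \<and>
         binary_tree G \<and> binary_tree H \<and>
         card (verts G) \<le> 30000 * N * D ^ 1 \<and> card (verts H) \<le> 30000 * N * D ^ 1 \<and>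
         real (depth G) \<le> 2 * log 2 (real N) + real 30000 * log 2 (real D) \<and>
         real (depth H) \<le> 2 * log 2 (real N) + real 30000 * log 2 (real D) \<and>
         (OAPT t A B \<longleftrightarrow> Subtree_Iso G H)"
    using reduction_correct[OF inst order.refl] assms
    unfolding runs_def l by (auto simp: D mult.assoc)
qed

end
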